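(* Let $P\in\mathbb{C}[z]$ be an odd polynomial (i.e. $P(-z)=-P(z)$ identically) of degree $d\ge 3$ with $P(0)=0$ and $P'(0)=1$. Then $$\max_{\zeta\in\mathbb{C},\ P'(\zeta)=0}\left|\frac{P(\zeta)}{\zeta}\right|\ \ge\ \frac{1}{d}.$$
   Context: Polynomials have complex coefficients. A critical point of $P$ is a point $\zeta\in\mathbb{C}$ with $P'(\zeta)=0$; the maximum is taken over all critical points of $P$ (a finite nonempty set, not containing $0$ since $P'(0)=1$). *)

theory Defs
  imports Complex_Main "HOL-Computational_Algebra.Polynomial"
begin

end

theory Submission
  imports Defs "HOL-Complex_Analysis.Complex_Analysis" "HOL-Real_Asymp.Real_Asymp"
    "HOL-Computational_Algebra.Fundamental_Theorem_Algebra"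
begin

text \<open>
  The theorem is a shadow of an inequality for arbitrary polynomials: if \<open>p\<close> has degree
  \<open>n \<ge> 2\<close>, \<open>p(0) = 0\<close> and \<open>p'(0) \<noteq> 0\<close>, then some critical point \<open>\<omega>\<close> with
  \<open>p(\<omega>) \<noteq> 0\<close> satisfies \<open>\<bar>p'(0)\<bar> \<bar>\<omega>\<bar> \<le> n\<^sup>2 \<bar>p(\<omega>)\<bar>\<close> (\<open>critical_value_bound\<close>). The square of an
  odd polynomial \<open>P\<close> of degree \<open>d\<close> has the form \<open>P(z)\<^sup>2 = p(z\<^sup>2)\<close> with \<open>p\<close> again of degree
  \<open>d\<close>, and a critical point \<open>\<omega>\<close> of \<open>p\<close> that is not a zero of \<open>p\<close> gives a critical point
  \<open>\<zeta> = \<surd>\<omega>\<close> of \<open>P\<close>. Since \<open>\<bar>P(\<zeta>)/\<zeta>\<bar>\<^sup>2 = \<bar>p(\<omega>)/\<omega>\<bar>\<close>, the factor \<open>d\<^sup>2\<close> turns into \<open>d\<close>.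

  The inequality for \<open>p\<close> is Markov's inequality at the end point of a curve. Let \<open>\<phi>\<close> be the
  inverse branch of \<open>p\<close> at \<open>0\<close>, continued to the largest possible disc around \<open>0\<close>. The
  obstruction to continuing it further is a critical point \<open>\<omega>\<close>, reached by \<open>\<phi>\<close> along some
  radius \<open>[0, \<xi>]\<close> of that disc (\<open>critical_point_on_ray\<close>). The closure \<open>\<Gamma>\<close> of the image of
  this radius is a continuum that contains \<open>0\<close> and \<open>\<omega>\<close> and on which \<open>p/\<xi>\<close> takes values in
  \<open>[0,1]\<close>. If \<open>\<Gamma>\<close> were the segment \<open>[0, \<omega>]\<close>, Markov's inequality for \<open>p/\<xi>\<close> would read
  \<open>\<bar>p'(0)/\<xi>\<bar> \<le> n\<^sup>2/\<bar>\<omega>\<bar>\<close>, which is the claim because \<open>\<xi> = p(\<omega>)\<close>.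

  For a general \<open>\<Gamma>\<close> one compares growth rates near the tip \<open>0\<close>. The Bernstein--Walsh
  inequality (\<open>bernstein_walsh\<close>), applied to iterates of the logistic map \<open>4x(1 - x)\<close> composed
  with \<open>p/\<xi>\<close>, bounds \<open>p/\<xi>\<close> off \<open>\<Gamma>\<close> in terms of the Riemann map of the exterior of \<open>\<Gamma>\<close>; these
  iterates play the role of the Chebyshev polynomials, and
  \<open>- sinh\<^sup>2 y \<mapsto> - sinh\<^sup>2 (2 y)\<close> under the logistic map makes their growth explicit. On the other
  side, the Riemann map omits \<open>1/\<omega>\<close>, and among all continua joining \<open>0\<close> to \<open>\<omega>\<close> the segment is
  the worst case for its growth (\<open>growth_of_univalent_omitting\<close>, a form of the Koebe quarter
  theorem). Letting the point tend to \<open>0\<close> along \<open>\<phi>\<close> of the radius opposite to \<open>\<xi>\<close> gives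
  the factor \<open>n\<^sup>2\<close>.

  The sharp Koebe constant is obtained here without areas. It amounts to
  \<open>\<bar>\<sigma>'(0)\<bar> \<le> 2 \<bar>\<sigma>(0)\<bar>\<close> for a function \<open>\<sigma>\<close> on the unit disc whose values never are opposite to
  each other. This follows from positivity of logarithmic energy for finitely many unit charges
  at points \<open>\<sigma>(z\<^sub>i)\<close> and opposite charges at \<open>-\<sigma>(z\<^sub>i)\<close>, where the \<open>z\<^sub>i\<close> are equally spaced on
  a circle.
\<close>

section \<open>Logarithmic energy of opposite points\<close>

text \<open>
  Expanding both powers by the binomial theorem, the monomial \<open>x\<^sup>k cnj x\<^sup>l\<close> in
  \<open>x = s\<^sub>i cnj s\<^sub>j\<close> survives only when \<open>k + l\<close> is odd, and then with a positive coefficient.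
  Each such monomial contributes a squared modulus to the quadratic form.
\<close>
lemma power_kernel_difference_nonneg:
  fixes s :: "'i \<Rightarrow> complex" and c :: "'i \<Rightarrow> real"
  shows "0 \<le> (\<Sum>i\<in>I. \<Sum>j\<in>I. c i * c j *
            ((cmod (1 + s i * cnj (s j)))^(2*n) - (cmod (1 - s i * cnj (s j)))^(2*n)))"
proof -
  define A where "A k l = (\<Sum>i\<in>I. complex_of_real (c i) * s i ^ k * cnj (s i) ^ l)" for k l
  define q :: "nat \<Rightarrow> nat \<Rightarrow> real"
    where "q k l = real (n choose k) * real (n choose l) * (1 - (-1) ^ (k + l))" for k l
  have q_nonneg: "q k l \<ge> 0" for k l
    unfolding q_def by (intro mult_nonneg_nonneg) (auto simp: minus_one_power_iff)
  have expand: "complex_of_real ((cmod (1 + x))^(2*n) - (cmod (1 - x))^(2*n))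
      = (\<Sum>k\<le>n. \<Sum>l\<le>n. of_real (q k l) * (x ^ k * cnj x ^ l))" for x
  proof -
    have sq: "complex_of_real ((cmod y)^(2*n)) = y ^ n * cnj y ^ n" for y
      by (simp only: power_mult of_real_power complex_norm_square[symmetric] power_mult_distrib[symmetric])
    have bin: "(1 + x) ^ n * (1 + y) ^ n
        = (\<Sum>k\<le>n. \<Sum>l\<le>n. of_nat (n choose k) * of_nat (n choose l) * (x ^ k * y ^ l))"
      for x y :: complex
      by (subst (1 2) add.commute) (simp add: binomial_ring sum_product mult_ac)
    have "complex_of_real ((cmod (1 + x))^(2*n) - (cmod (1 - x))^(2*n))
        = (1 + x) ^ n * (1 + cnj x) ^ n - (1 + (- x)) ^ n * (1 + (- cnj x)) ^ n"
      unfolding of_real_diff sq by simp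
    also have "\<dots> = (\<Sum>k\<le>n. \<Sum>l\<le>n. of_nat (n choose k) * of_nat (n choose l) *
                        (x ^ k * cnj x ^ l - (- x) ^ k * (- cnj x) ^ l))"
      unfolding bin by (simp only: sum_subtractf[symmetric] right_diff_distrib)
    also have "\<dots> = (\<Sum>k\<le>n. \<Sum>l\<le>n. of_real (q k l) * (x ^ k * cnj x ^ l))"
    proof (intro sum.cong refl)
      fix k l
      have "(- x) ^ k * (- cnj x) ^ l = (-1) ^ (k + l) * (x ^ k * cnj x ^ l)"
        by (subst (1 2) power_minus) (simp add: power_add)
      then show "of_nat (n choose k) * of_nat (n choose l) *
            (x ^ k * cnj x ^ l - (- x) ^ k * (- cnj x) ^ l) = of_real (q k l) * (x ^ k * cnj x ^ l)"
        by (simp add: q_def algebra_simps)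
    qed
    finally show ?thesis .
  qed
  have "complex_of_real (\<Sum>i\<in>I. \<Sum>j\<in>I. c i * c j *
            ((cmod (1 + s i * cnj (s j)))^(2*n) - (cmod (1 - s i * cnj (s j)))^(2*n)))
      = (\<Sum>i\<in>I. \<Sum>j\<in>I. \<Sum>k\<le>n. \<Sum>l\<le>n. of_real (q k l) *
           ((c i * s i ^ k * cnj (s i) ^ l) * cnj (c j * s j ^ k * cnj (s j) ^ l)))"
    unfolding of_real_sum of_real_mult expand sum_distrib_left
    by (intro sum.cong refl) (simp add: power_mult_distrib mult_ac)
  also have "\<dots> = (\<Sum>k\<le>n. \<Sum>l\<le>n. \<Sum>i\<in>I. \<Sum>j\<in>I. of_real (q k l) *
           ((c i * s i ^ k * cnj (s i) ^ l) * cnj (c j * s j ^ k * cnj (s j) ^ l)))"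
    by (subst (2) sum.swap, subst sum.swap, subst (3) sum.swap, subst (2) sum.swap) (rule refl)
  also have "\<dots> = (\<Sum>k\<le>n. \<Sum>l\<le>n. of_real (q k l) * (A k l * cnj (A k l)))"
  proof (intro sum.cong refl)
    fix k l
    have "A k l * cnj (A k l) = (\<Sum>i\<in>I. \<Sum>j\<in>I.
            (c i * s i ^ k * cnj (s i) ^ l) * cnj (c j * s j ^ k * cnj (s j) ^ l))"
      unfolding A_def cnj_sum by (rule sum_product)
    then show "(\<Sum>i\<in>I. \<Sum>j\<in>I. of_real (q k l) *
           ((c i * s i ^ k * cnj (s i) ^ l) * cnj (c j * s j ^ k * cnj (s j) ^ l)))
         = of_real (q k l) * (A k l * cnj (A k l))"
      by (simp only: sum_distrib_left)
  qed
  also have "\<dots> = complex_of_real (\<Sum>k\<le>n. \<Sum>l\<le>n. q k l * (cmod (A k l))\<^sup>2)"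
    by (simp only: of_real_sum of_real_mult complex_norm_square)
  finally have "(\<Sum>i\<in>I. \<Sum>j\<in>I. c i * c j *
            ((cmod (1 + s i * cnj (s j)))^(2*n) - (cmod (1 - s i * cnj (s j)))^(2*n)))
      = (\<Sum>k\<le>n. \<Sum>l\<le>n. q k l * (cmod (A k l))\<^sup>2)"
    using of_real_eq_iff by blast
  then show ?thesis
    using q_nonneg by (auto intro!: sum_nonneg mult_nonneg_nonneg)
qed

text \<open>
  A quarter of the squared chordal distance of \<open>p\<close> and \<open>q\<close> on the Riemann sphere. It replaces
  \<open>\<bar>p - q\<bar>\<^sup>2\<close> because \<open>1 - chord p q\<close> is the squared modulus of an inner product of unit vectors
  of \<open>\<complex>\<^sup>2\<close>, so that \<open>- ln (chord p q)\<close> is a power series with positive coefficients in a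
  positive definite kernel.
\<close>
definition chord :: "complex \<Rightarrow> complex \<Rightarrow> real"
  where "chord p q = (cmod (p - q))\<^sup>2 / ((1 + (cmod p)\<^sup>2) * (1 + (cmod q)\<^sup>2))"

lemma chord_alt: "1 - chord p q = (cmod (1 + p * cnj q))\<^sup>2 / ((1 + (cmod p)\<^sup>2) * (1 + (cmod q)\<^sup>2))"
proof -
  have "(cmod (1 + p * cnj q))\<^sup>2 = (1 + (cmod p)\<^sup>2) * (1 + (cmod q)\<^sup>2) - (cmod (p - q))\<^sup>2"
    unfolding cmod_power2 by (simp add: power2_eq_square algebra_simps)
  moreover have "(1 + (cmod p)\<^sup>2) * (1 + (cmod q)\<^sup>2) > 0"
    by (intro mult_pos_pos add_pos_nonneg) auto
  ultimately show ?thesis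
    by (simp add: chord_def field_simps)
qed

lemma chord_nonneg: "chord p q \<ge> 0"
  unfolding chord_def by (intro divide_nonneg_nonneg mult_nonneg_nonneg) auto

lemma chord_le_1: "chord p q \<le> 1"
proof -
  have "1 - chord p q \<ge> 0"
    unfolding chord_alt by (intro divide_nonneg_nonneg mult_nonneg_nonneg) auto
  then show ?thesis by simp
qed

lemma chord_refl [simp]: "chord p p = 0"
  by (simp add: chord_def)

text \<open>
  Positivity of the logarithmic energy of charges \<open>+1\<close> at the \<open>s\<^sub>i\<close> and \<open>-1\<close> at the \<open>-s\<^sub>i\<close>:
  expand \<open>ln (1 - \<theta> x)\<close> in powers of \<open>x\<close> and use positivity of each power kernel. The
  parameter \<open>\<theta> < 1\<close> keeps the diagonal terms, the self-energies, finite.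
\<close>
lemma chordal_energy_nonneg:
  fixes s :: "'i \<Rightarrow> complex"
  assumes "finite I" and "0 \<le> \<theta>" and "\<theta> < 1"
  shows "(\<Prod>i\<in>I. \<Prod>j\<in>I. 1 - \<theta> * (1 - chord (s i) (s j)))
       \<le> (\<Prod>i\<in>I. \<Prod>j\<in>I. 1 - \<theta> * (1 - chord (s i) (- s j)))"
proof -
  define K L where "K i j = 1 - chord (s i) (s j)" and "L i j = 1 - chord (s i) (- s j)" for i j
  have bnd: "0 \<le> K i j" "K i j \<le> 1" "0 \<le> L i j" "L i j \<le> 1" for i j
    using chord_nonneg chord_le_1 by (auto simp: K_def L_def)
  have lt: "\<theta> * x < 1" if "x \<le> 1" for x
    using that assms(2,3) by (meson mult_left_le order_le_less_trans)
  have ser: "(\<lambda>n. - ((\<theta> * x) ^ n / real n)) sums ln (1 - \<theta> * x)" if "0 \<le> x" "x \<le> 1" for x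
  proof -
    have "\<bar>- (\<theta> * x)\<bar> < 1"
      using that lt[of x] assms(2) by (simp add: abs_mult)
    from ln_series'[OF this] show ?thesis by simp
  qed
  have term_nonneg: "(\<Sum>i\<in>I. \<Sum>j\<in>I. (- ((\<theta> * L i j) ^ n / real n)) - (- ((\<theta> * K i j) ^ n / real n))) \<ge> 0" for n
  proof -
    define c where "c i = 1 / (1 + (cmod (s i))\<^sup>2) ^ n" for i
    have "(\<Sum>i\<in>I. \<Sum>j\<in>I. (- ((\<theta> * L i j) ^ n / real n)) - (- ((\<theta> * K i j) ^ n / real n)))
        = \<theta> ^ n / real n * (\<Sum>i\<in>I. \<Sum>j\<in>I. c i * c j *
            ((cmod (1 + s i * cnj (s j)))^(2*n) - (cmod (1 - s i * cnj (s j)))^(2*n)))"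
      unfolding sum_distrib_left
    proof (intro sum.cong refl)
      fix i j
      have K: "(\<theta> * K i j) ^ n = \<theta> ^ n * (c i * c j * (cmod (1 + s i * cnj (s j)))^(2*n))"
        unfolding K_def chord_alt c_def
        by (simp add: power_mult_distrib power_divide power_mult)
      have L: "(\<theta> * L i j) ^ n = \<theta> ^ n * (c i * c j * (cmod (1 - s i * cnj (s j)))^(2*n))"
        unfolding L_def chord_alt c_def
        by (simp add: power_mult_distrib power_divide power_mult)
      show "- ((\<theta> * L i j) ^ n / real n) - - ((\<theta> * K i j) ^ n / real n)
          = \<theta> ^ n / real n * (c i * c j *
            ((cmod (1 + s i * cnj (s j)))^(2*n) - (cmod (1 - s i * cnj (s j)))^(2*n)))"
        unfolding K L by (cases "n = 0") (simp_all add: field_simps)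
    qed
    also have "\<dots> \<ge> 0"
      using power_kernel_difference_nonneg[of c s n I] assms(2) by (intro mult_nonneg_nonneg) auto
    finally show ?thesis .
  qed
  have tot: "(\<lambda>n. \<Sum>i\<in>I. \<Sum>j\<in>I. (- ((\<theta> * L i j) ^ n / real n)) - (- ((\<theta> * K i j) ^ n / real n)))
      sums (\<Sum>i\<in>I. \<Sum>j\<in>I. ln (1 - \<theta> * L i j) - ln (1 - \<theta> * K i j))"
    by (intro sums_sum sums_diff ser bnd)
  have "0 \<le> (\<Sum>i\<in>I. \<Sum>j\<in>I. ln (1 - \<theta> * L i j) - ln (1 - \<theta> * K i j))"
    by (rule sums_le[OF _ sums_zero tot]) (rule term_nonneg)
  then have le: "(\<Sum>i\<in>I. \<Sum>j\<in>I. ln (1 - \<theta> * K i j)) \<le> (\<Sum>i\<in>I. \<Sum>j\<in>I. ln (1 - \<theta> * L i j))"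
    by (simp add: sum_subtractf)
  have ex: "(\<Prod>i\<in>I. \<Prod>j\<in>I. 1 - \<theta> * X i j) = exp (\<Sum>i\<in>I. \<Sum>j\<in>I. ln (1 - \<theta> * X i j))"
    if "\<And>i j. X i j \<le> 1" for X
    using assms(1) lt[OF that] by (simp add: exp_sum)
  show ?thesis
    using le bnd ex[of K] ex[of L] by (simp add: K_def L_def)
qed

text \<open>
  The left-hand side has about \<open>N\<^sup>2\<close> factors, whereas the bound grows only like \<open>exp (N ln N)\<close>.
  With \<open>B\<close> fixed, the geometric mean of the factors is therefore asymptotically at most \<open>1\<close>, and
  this is what the limit of large \<open>N\<close> uses.
\<close>
lemma opposite_points_product_bound:
  fixes s :: "'i \<Rightarrow> complex"
  assumes fin: "finite I" and ne: "I \<noteq> {}"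
    and opp: "\<And>i j. i \<in> I \<Longrightarrow> j \<in> I \<Longrightarrow> s i + s j \<noteq> 0"
    and B: "\<And>i j. i \<in> I \<Longrightarrow> j \<in> I \<Longrightarrow>
              (1 + (cmod (s i))\<^sup>2) * (1 + (cmod (s j))\<^sup>2) \<le> B * (cmod (s i + s j))\<^sup>2"
  shows "(\<Prod>i\<in>I. \<Prod>j\<in>I - {i}. (cmod ((s i - s j) / (s i + s j)))\<^sup>2)
           \<le> real (card I) ^ card I * exp (B * real (card I))"
proof -
  define N where "N = card I"
  have N: "N \<ge> 1" using fin ne by (simp add: N_def Suc_leI card_gt_0_iff)
  \<comment> \<open>With this choice the self-energy terms cost a factor \<open>N\<^sup>N\<close>, and replacing \<open>\<theta>\<close> by \<open>1\<close> in the
    \<open>N\<^sup>2\<close> mixed terms, where the distances are bounded below, costs a factor \<open>exp (B N)\<close>.\<close>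
  define \<theta> where "\<theta> = 1 - 1 / real N"
  have \<theta>: "0 \<le> \<theta>" "\<theta> < 1" using N by (auto simp: \<theta>_def)
  define D where "D i j = chord (s i) (s j)" for i j
  define S where "S i j = chord (s i) (- s j)" for i j
  have pos: "(1 + (cmod p)\<^sup>2) * (1 + (cmod q)\<^sup>2) > 0" for p q
    by (intro mult_pos_pos add_pos_nonneg) auto
  have S_pos: "S i j > 0" if "i \<in> I" "j \<in> I" for i j
    unfolding S_def chord_def using pos[of "s i" "- s j"] opp[OF that] by simp
  have S_lower: "1 \<le> B * S i j" if "i \<in> I" "j \<in> I" for i j
    unfolding S_def chord_def using pos[of "s i" "s j"] B[OF that] by (simp add: field_simps)
  have quot: "(cmod ((s i - s j) / (s i + s j)))\<^sup>2 * S i j = D i j" if "i \<in> I" "j \<in> I" for i j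
    unfolding S_def D_def chord_def using opp[OF that] by (simp add: norm_divide power_divide)
  have split: "(\<Prod>i\<in>I. \<Prod>j\<in>I. X i j) = (\<Prod>i\<in>I. X i i) * (\<Prod>i\<in>I. \<Prod>j\<in>I - {i}. X i j)"
    for X :: "'i \<Rightarrow> 'i \<Rightarrow> real"
    unfolding prod.distrib[symmetric] by (intro prod.cong refl prod.remove fin)
  have low: "(1 - \<theta>) ^ N * (\<Prod>i\<in>I. \<Prod>j\<in>I - {i}. D i j)
      \<le> (\<Prod>i\<in>I. \<Prod>j\<in>I. 1 - \<theta> * (1 - D i j))"
  proof -
    have "(\<Prod>i\<in>I. \<Prod>j\<in>I - {i}. D i j) \<le> (\<Prod>i\<in>I. \<Prod>j\<in>I - {i}. 1 - \<theta> * (1 - D i j))"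
    proof (intro prod_mono conjI prod_nonneg)
      fix i j
      show "D i j \<le> 1 - \<theta> * (1 - D i j)"
        using mult_right_mono[of \<theta> 1 "1 - D i j"] \<theta> chord_le_1 by (simp add: D_def)
    qed (auto simp: D_def chord_nonneg)
    moreover have "(\<Prod>i\<in>I. 1 - \<theta> * (1 - D i i)) = (1 - \<theta>) ^ N"
      by (simp add: D_def N_def)
    ultimately show ?thesis
      using \<theta> by (subst split) (simp add: mult_left_mono)
  qed
  have high: "(\<Prod>i\<in>I. \<Prod>j\<in>I. 1 - \<theta> * (1 - S i j)) \<le> exp (B * N) * (\<Prod>i\<in>I. \<Prod>j\<in>I - {i}. S i j)"
  proof -
    have "(\<Prod>i\<in>I. \<Prod>j\<in>I. 1 - \<theta> * (1 - S i j)) \<le> (\<Prod>i\<in>I. \<Prod>j\<in>I. exp (B / N) * S i j)"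
    proof -
      have *: "0 \<le> 1 - \<theta> * (1 - S i j) \<and> 1 - \<theta> * (1 - S i j) \<le> exp (B / N) * S i j"
        if ij: "i \<in> I" "j \<in> I" for i j
      proof
      have S01: "0 \<le> 1 - S i j" "1 - S i j \<le> 1"
        using chord_nonneg chord_le_1 by (auto simp: S_def)
      then have *: "\<theta> * (1 - S i j) \<le> 1"
        using \<theta> by (meson mult_left_le less_imp_le order_trans)
      then show "0 \<le> 1 - \<theta> * (1 - S i j)" by simp
      have "1 - \<theta> * (1 - S i j) \<le> S i j + 1 / N * 1"
        using N S01 by (simp add: \<theta>_def field_simps)
      also have "\<dots> \<le> S i j + 1 / N * (B * S i j)"
        using S_lower[OF ij] N by (intro add_left_mono mult_left_mono) auto
      also have "\<dots> = (1 + B / N) * S i j" by (simp add: algebra_simps)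
      also have "\<dots> \<le> exp (B / N) * S i j"
        using S_pos[OF ij] by (intro mult_right_mono exp_ge_add_one_self) auto
      finally show "1 - \<theta> * (1 - S i j) \<le> exp (B / N) * S i j" .
      qed
      then show ?thesis by (intro prod_mono conjI prod_nonneg) auto
    qed
    also have "\<dots> = exp (B / N) ^ (N * N) * (\<Prod>i\<in>I. \<Prod>j\<in>I. S i j)"
      by (simp add: prod.distrib N_def power_mult)
    also have "exp (B / N) ^ (N * N) = exp (B * N)"
      using N by (simp add: exp_of_nat_mult[symmetric])
    also have "(\<Prod>i\<in>I. \<Prod>j\<in>I. S i j) \<le> (\<Prod>i\<in>I. \<Prod>j\<in>I - {i}. S i j)"
    proof -
      have "(\<Prod>i\<in>I. S i i) \<le> 1"
        using chord_le_1 chord_nonneg by (intro prod_le_1) (auto simp: S_def)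
      moreover have "0 \<le> (\<Prod>i\<in>I. \<Prod>j\<in>I - {i}. S i j)"
        using chord_nonneg by (intro prod_nonneg) (auto simp: S_def)
      ultimately show ?thesis
        unfolding split[of S] using mult_right_mono by fastforce
    qed
    finally show ?thesis by simp
  qed
  have Dprod: "(\<Prod>i\<in>I. \<Prod>j\<in>I - {i}. D i j)
     = (\<Prod>i\<in>I. \<Prod>j\<in>I - {i}. (cmod ((s i - s j) / (s i + s j)))\<^sup>2) * (\<Prod>i\<in>I. \<Prod>j\<in>I - {i}. S i j)"
    unfolding prod.distrib[symmetric] using quot by (intro prod.cong refl) auto
  have Spos: "0 < (\<Prod>i\<in>I. \<Prod>j\<in>I - {i}. S i j)"
    using S_pos by (intro prod_pos) auto
  have "(1 - \<theta>) ^ N * (\<Prod>i\<in>I. \<Prod>j\<in>I - {i}. D i j) \<le> exp (B * N) * (\<Prod>i\<in>I. \<Prod>j\<in>I - {i}. S i j)"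
    using low high chordal_energy_nonneg[OF fin \<theta>, of s] by (simp add: D_def S_def)
  then have "(1 / real N) ^ N * (\<Prod>i\<in>I. \<Prod>j\<in>I - {i}. (cmod ((s i - s j) / (s i + s j)))\<^sup>2) \<le> exp (B * N)"
    unfolding Dprod \<theta>_def using Spos by (simp add: mult.assoc[symmetric])
  then show ?thesis
    using N by (simp add: N_def power_one_over field_simps)
qed

section \<open>Growth of univalent functions omitting a value\<close>

text \<open>
  Both sides are the modulus of the derivative of \<open>z\<^sup>N - 1\<close> at one of its roots.
\<close>
lemma roots_of_unity_product:
  fixes N :: nat
  assumes "N \<ge> 1"
  defines "\<omega> \<equiv> (\<lambda>k::nat. cis (2 * pi * real k / real N))"
  assumes "i < N"
  shows "cmod (\<Prod>j\<in>{..<N} - {i}. \<omega> i - \<omega> j) = real N"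
proof -
  define p :: "complex poly" where "p = monom 1 N - 1"
  define q :: "complex poly" where "q = (\<Prod>j<N. [:- \<omega> j, 1:])"
  have bij: "bij_betw \<omega> {..<N} {z. z ^ N = 1}"
    unfolding \<omega>_def using Complex.bij_betw_roots_unity[of N] assms(1) by simp
  have roots: "poly p x = 0 \<and> poly q x = 0" if "x \<in> \<omega> ` {..<N}" for x
    using that bij by (auto simp: p_def q_def poly_prod poly_monom bij_betw_def)
  have monic_q: "lead_coeff q = 1" "degree q = N"
  proof -
    show "lead_coeff q = 1" unfolding q_def lead_coeff_prod by simp
    show "degree q = N" unfolding q_def by (subst degree_prod_eq_sum_degree) auto
  qed
  have deg_p: "degree p = N" "lead_coeff p = 1"
  proof -
    show "degree p = N"
      using assms(1) degree_add_eq_left[of "-1" "monom (1::complex) N"]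
      by (simp add: p_def degree_monom_eq)
    then show "lead_coeff p = 1"
      using assms(1) by (simp add: p_def)
  qed
  have "p - q = 0"
  proof (rule ccontr)
    assume nz: "p - q \<noteq> 0"
    have "degree (p - q) \<le> N"
      by (rule degree_diff_le) (simp_all add: deg_p(1) monic_q(2))
    moreover have "degree (p - q) \<noteq> N"
    proof
      assume "degree (p - q) = N"
      then have "coeff p N - coeff q N \<noteq> 0"
        using leading_coeff_neq_0[OF nz] by simp
      then show False
        using deg_p monic_q by simp
    qed
    ultimately have "degree (p - q) < N" by linarith
    moreover have "card (\<omega> ` {..<N}) \<le> card {x. poly (p - q) x = 0}"
      using roots by (intro card_mono poly_roots_finite nz) auto
    moreover have "card (\<omega> ` {..<N}) = N"
      using bij_betw_same_card[OF bij] bij by (simp add: bij_betw_def)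
    ultimately show False
      using card_poly_roots_bound[OF nz] by linarith
  qed
  then have "poly (pderiv p) (\<omega> i) = poly (pderiv q) (\<omega> i)" by simp
  also have "\<dots> = (\<Sum>a<N. \<Prod>j\<in>{..<N} - {a}. \<omega> i - \<omega> j)"
    by (simp add: q_def pderiv_prod poly_sum poly_prod pderiv_pCons)
  also have "\<dots> = (\<Sum>a\<in>{i}. \<Prod>j\<in>{..<N} - {a}. \<omega> i - \<omega> j)"
    using assms(3) by (intro sum.mono_neutral_right) auto
  finally have "(\<Prod>j\<in>{..<N} - {i}. \<omega> i - \<omega> j) = of_nat N * \<omega> i ^ (N - 1)"
    by (simp add: p_def pderiv_diff pderiv_monom poly_monom)
  then show ?thesis
    by (simp add: norm_mult norm_power \<omega>_def)
qed

lemma geometric_growth_le_one: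
  fixes x C :: real
  assumes "\<And>N. N \<ge> 2 \<Longrightarrow> x ^ (N - 1) \<le> real N * C" and "x \<ge> 0"
  shows "x \<le> 1"
proof (rule ccontr)
  assume "\<not> x \<le> 1"
  then have "(\<lambda>n. (real n + 1) * C / x ^ n) \<longlonglongrightarrow> 0"
    by real_asymp
  then have "\<forall>\<^sub>F n in sequentially. (real n + 1) * C / x ^ n < 1"
    by (rule order_tendstoD) simp
  then have "\<forall>\<^sub>F n in sequentially. (real n + 1) * C / x ^ n < 1 \<and> n \<ge> 1"
    using eventually_ge_at_top[of 1] by (rule eventually_conj)
  then obtain n where n: "(real n + 1) * C / x ^ n < 1" "n \<ge> 1"
    by (auto simp: eventually_sequentially)
  have "(real n + 1) * C < x ^ n"
    using n(1) \<open>\<not> x \<le> 1\<close> by (simp add: divide_less_eq)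
  with assms(1)[of "Suc n"] n(2) show False by (simp add: add.commute)
qed

text \<open>
  Put \<open>N\<close> points \<open>z\<^sub>i\<close> equally spaced on the circle of radius \<open>r\<close>. The quotients
  \<open>(\<sigma> z\<^sub>i - \<sigma> z\<^sub>j) / ((z\<^sub>i - z\<^sub>j) (\<sigma> z\<^sub>i + \<sigma> z\<^sub>j))\<close> tend to \<open>\<sigma>'(0) / (2 \<sigma>(0))\<close> when all points are
  shrunk to \<open>0\<close>, and the maximum modulus principle in a common dilation and rotation factor
  \<open>t\<close> shows that for a suitable rotation their product on the circle is at least as large as in
  the limit. The energy bound for the values \<open>\<sigma> z\<^sub>i\<close> then limits \<open>\<sigma>'(0) / (2 \<sigma>(0))\<close>.
\<close>
lemma deriv_zero_bound_of_no_opposite_values: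
  assumes hol: "\<sigma> holomorphic_on ball 0 1"
    and opp: "\<And>z w. z \<in> ball 0 1 \<Longrightarrow> w \<in> ball 0 1 \<Longrightarrow> \<sigma> z + \<sigma> w \<noteq> 0"
  shows "cmod (deriv \<sigma> 0) \<le> 2 * cmod (\<sigma> 0)"
proof -
  define M where "M = cmod (deriv \<sigma> 0 / (2 * \<sigma> 0))"
  have \<sigma>0: "\<sigma> 0 \<noteq> 0" using opp[of 0 0] by auto
  have cont: "continuous_on (ball 0 1) \<sigma>"
    by (rule holomorphic_on_imp_continuous_on[OF hol])
  have step: "M * r \<le> 1" if r: "0 < r" "r < 1" for r
  proof -
    have sub: "cball 0 r \<subseteq> (ball 0 1 :: complex set)" using r by auto
    have contr: "continuous_on (cball 0 r) \<sigma>"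
      using cont sub continuous_on_subset by blast
    \<comment> \<open>On the compact disc of radius \<open>r\<close> the sums \<open>\<sigma> z + \<sigma> w\<close> stay away from \<open>0\<close>, with a bound \<open>B\<close>
      that does not depend on the number \<open>N\<close> of points.\<close>
    define Bf where "Bf = (\<lambda>(z, w). (1 + (cmod (\<sigma> z))\<^sup>2) * (1 + (cmod (\<sigma> w))\<^sup>2) / (cmod (\<sigma> z + \<sigma> w))\<^sup>2)"
    have "\<sigma> z + \<sigma> w \<noteq> 0" if "z \<in> cball 0 r" "w \<in> cball 0 r" for z w
      using that sub by (intro opp) auto
    then have "continuous_on (cball 0 r \<times> cball 0 r) Bf"
      unfolding Bf_def case_prod_unfold
      by (intro continuous_intros continuous_on_compose2[OF contr]) auto
    then have "compact (Bf ` (cball 0 r \<times> cball 0 r))"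
      by (intro compact_continuous_image compact_Times compact_cball)
    then obtain B where "\<forall>y\<in>Bf ` (cball 0 r \<times> cball 0 r). norm y \<le> B"
      using compact_imp_bounded bounded_iff by blast
    then have B: "Bf x \<le> B" if "x \<in> cball 0 r \<times> cball 0 r" for x
      using that by (metis abs_le_D1 imageI real_norm_def)
    have "((M * r)\<^sup>2) ^ (N - 1) \<le> real N * exp B" if N: "N \<ge> 2" for N
    proof -
      define \<omega> where "\<omega> = (\<lambda>k::nat. cis (2 * pi * real k / real N))"
      define I where "I = {..<N}"
      have norm\<omega>: "cmod (\<omega> k) = 1" for k by (simp add: \<omega>_def)
      define D where "D i j t = \<sigma> (\<omega> i * t) - \<sigma> (\<omega> j * t)" for i j t
      define q where "q i j t = (if t = 0 then deriv (D i j) 0 else (D i j t - D i j 0) / (t - 0))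
                        / (\<sigma> (\<omega> i * t) + \<sigma> (\<omega> j * t))" for i j t
      define h where "h t = (\<Prod>i\<in>I. \<Prod>j\<in>I - {i}. q i j t)" for t
      have rot: "(\<lambda>t. \<sigma> (\<omega> i * t)) holomorphic_on ball 0 1" for i
        by (rule holomorphic_on_compose_gen[OF _ hol, unfolded o_def])
           (auto intro!: holomorphic_intros simp: norm_mult norm\<omega>)
      have in1: "\<omega> i * t \<in> ball 0 1" if "t \<in> ball 0 1" for i t
        using that by (simp add: norm_mult norm\<omega>)
      have holD: "D i j holomorphic_on ball 0 1" for i j
        unfolding D_def by (intro holomorphic_intros rot)
      have holh: "h holomorphic_on ball 0 1"
        unfolding h_def q_def
        by (intro holomorphic_intros rot pole_lemma_open holD open_ball) (use opp in1 in auto)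
      have d0: "deriv (D i j) 0 = (\<omega> i - \<omega> j) * deriv \<sigma> 0" for i j
      proof -
        have "(\<sigma> has_field_derivative deriv \<sigma> 0) (at 0)"
          by (rule holomorphic_derivI[OF hol]) auto
        then have "((\<lambda>t. \<sigma> (\<omega> i * t)) has_field_derivative deriv \<sigma> 0 * \<omega> i) (at 0)" for i
          by (intro DERIV_chain2[of \<sigma>]) (auto intro!: derivative_eq_intros)
        then have "(D i j has_field_derivative deriv \<sigma> 0 * \<omega> i - deriv \<sigma> 0 * \<omega> j) (at 0)"
          unfolding D_def by (intro DERIV_diff)
        then show ?thesis by (simp add: DERIV_imp_deriv algebra_simps)
      qed
      have cardI: "card I = N" "\<And>i. i \<in> I \<Longrightarrow> card (I - {i}) = N - 1"
        by (auto simp: I_def)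
      have h0: "M ^ (N * (N - 1)) \<le> cmod (h 0)"
      proof -
        have "cmod (h 0) = (\<Prod>i\<in>I. \<Prod>j\<in>I - {i}. cmod (\<omega> i - \<omega> j) * M)"
          unfolding h_def prod_norm[symmetric] q_def d0
          by (simp add: M_def norm_mult norm_divide mult_ac)
        also have "\<dots> = (\<Prod>i\<in>I. M ^ (N - 1) * (\<Prod>j\<in>I - {i}. cmod (\<omega> i - \<omega> j)))"
          by (intro prod.cong refl) (simp add: prod.distrib cardI)
        also have "\<dots> = (\<Prod>i\<in>I. M ^ (N - 1) * real N)"
          using roots_of_unity_product[of N] N
          by (intro prod.cong refl) (simp add: I_def \<omega>_def prod_norm)
        also have "\<dots> = M ^ (N * (N - 1)) * real N ^ N"
          by (simp add: cardI power_mult_distrib power_mult[symmetric] mult.commute)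
        also have "\<dots> \<ge> M ^ (N * (N - 1)) * 1"
          using N by (intro mult_left_mono) (auto simp: M_def)
        finally show ?thesis by simp
      qed
      \<comment> \<open>The product \<open>h\<close> is holomorphic in \<open>t\<close>, so a rotation \<open>t\<close> of the points on the circle does at
        least as well as their confluence at \<open>0\<close>.\<close>
      obtain t where t: "cmod t = r" "cmod (h 0) \<le> cmod (h t)"
      proof -
        have conth: "continuous_on (cball 0 r) h"
          using holh sub by (meson continuous_on_subset holomorphic_on_imp_continuous_on)
        have "compact (sphere 0 r :: complex set)" "sphere 0 r \<noteq> ({} :: complex set)"
          using r by auto
        moreover have "continuous_on (sphere 0 r) (\<lambda>t. cmod (h t))"
          using conth by (intro continuous_on_norm) (auto intro: continuous_on_subset)
        ultimately obtain t where t: "t \<in> sphere 0 r" "\<And>y. y \<in> sphere 0 r \<Longrightarrow> cmod (h y) \<le> cmod (h t)"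
          by (metis continuous_attains_sup)
        have "cmod (h 0) \<le> cmod (h t)"
          by (rule maximum_modulus_frontier[of h "cball 0 r"])
             (use t conth holh sub r in \<open>auto intro: holomorphic_on_subset[OF holh]\<close>)
        with t(1) show ?thesis by (intro that[of t]) auto
      qed
      have t0: "t \<noteq> 0" and t1: "t \<in> ball 0 1" using t(1) r by auto
      define s where "s i = \<sigma> (\<omega> i * t)" for i
      have pt: "\<omega> i * t \<in> cball 0 r" for i
        using t(1) by (simp add: norm_mult norm\<omega>)
      have opps: "s i + s j \<noteq> 0" for i j
        unfolding s_def using in1[OF t1] by (intro opp) auto
      have ht: "(cmod (h t))\<^sup>2 * (r\<^sup>2) ^ (N * (N - 1))
          = (\<Prod>i\<in>I. \<Prod>j\<in>I - {i}. (cmod ((s i - s j) / (s i + s j)))\<^sup>2)"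
      proof -
        have "(\<Prod>i\<in>I. \<Prod>j\<in>I - {i}. (cmod ((s i - s j) / (s i + s j)))\<^sup>2)
            = (\<Prod>i\<in>I. \<Prod>j\<in>I - {i}. (cmod (q i j t))\<^sup>2 * r\<^sup>2)"
          using t0 t(1) r
          by (intro prod.cong refl) (simp add: q_def D_def s_def norm_divide norm_mult power_divide power_mult_distrib)
        also have "\<dots> = (cmod (h t))\<^sup>2 * (\<Prod>i\<in>I. \<Prod>j\<in>I - {i}. r\<^sup>2)"
          by (simp only: h_def prod.distrib prod_norm[symmetric] prod_power_distrib)
        also have "(\<Prod>i\<in>I. \<Prod>j\<in>I - {i}. r\<^sup>2) = (r\<^sup>2) ^ (N * (N - 1))"
          by (simp add: cardI power_mult[symmetric] mult_ac)
        finally show ?thesis by simp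
      qed
      have "(M ^ (N * (N - 1)))\<^sup>2 * (r\<^sup>2) ^ (N * (N - 1)) \<le> (cmod (h t))\<^sup>2 * (r\<^sup>2) ^ (N * (N - 1))"
        using h0 t(2) by (intro mult_right_mono power_mono) (auto simp: M_def)
      also have "\<dots> \<le> real (card I) ^ card I * exp (B * real (card I))"
        unfolding ht
      proof (rule opposite_points_product_bound)
        show "finite I" "I \<noteq> {}" using N by (auto simp: I_def lessThan_empty_iff)
        fix i j
        have "Bf (\<omega> i * t, \<omega> j * t) \<le> B" using pt by (intro B) auto
        then show "(1 + (cmod (s i))\<^sup>2) * (1 + (cmod (s j))\<^sup>2) \<le> B * (cmod (s i + s j))\<^sup>2"
          using opps[of i j] by (simp add: Bf_def s_def field_simps)
      qed (use opps in auto)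
      also have "\<dots> = (real N * exp B) ^ N"
        by (simp add: cardI power_mult_distrib exp_of_nat_mult[symmetric] mult.commute)
      finally have "(((M * r)\<^sup>2) ^ (N - 1)) ^ N \<le> (real N * exp B) ^ N"
        by (simp add: power_mult_distrib power_mult[symmetric] mult_ac)
      then show ?thesis
        using N by (meson power_mono_iff less_le_trans pos2 zero_le_power2 zero_le_power exp_ge_zero mult_nonneg_nonneg of_nat_0_le_iff)
    qed
    then have "(M * r)\<^sup>2 \<le> 1"
      by (intro geometric_growth_le_one[of _ "exp B"]) auto
    then show ?thesis
      by (simp add: power_le_one_iff abs_square_le_1)
  qed
  have "((\<lambda>r. M * r) \<longlongrightarrow> M * 1) (at_left 1)"
    by (intro tendsto_intros)
  moreover have "\<forall>\<^sub>F r in at_left (1::real). M * r \<le> 1"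
    by (rule eventually_mono[OF eventually_at_left_real[of 0 1]]) (auto intro: step)
  ultimately have "M * 1 \<le> 1"
    by (intro tendsto_upperbound[where F = "at_left (1::real)"]) auto
  then show ?thesis
    using \<sigma>0 by (simp add: M_def norm_divide norm_mult divide_le_eq)
qed

text \<open>
  The hypothesis is invariant under automorphisms of the disc, which move \<open>a\<close> to \<open>0\<close>.
\<close>
lemma deriv_bound_of_no_opposite_values:
  assumes hol: "\<sigma> holomorphic_on ball 0 1"
    and opp: "\<And>z w. z \<in> ball 0 1 \<Longrightarrow> w \<in> ball 0 1 \<Longrightarrow> \<sigma> z + \<sigma> w \<noteq> 0"
    and a: "a \<in> ball 0 1"
  shows "cmod (deriv \<sigma> a) * (1 - (cmod a)\<^sup>2) \<le> 2 * cmod (\<sigma> a)"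
proof -
  define m where "m = Moebius_function 0 (- a)"
  have ma: "cmod (- a) < 1" using a by simp
  have m_hol: "m holomorphic_on ball 0 1"
    unfolding m_def by (rule Moebius_function_holomorphic[OF ma])
  have m_in: "m u \<in> ball 0 1" if "u \<in> ball 0 1" for u
    using Moebius_function_norm_lt_1[OF ma, of u] that by (simp add: m_def)
  have m0: "m 0 = a" by (simp add: m_def Moebius_function_of_zero)
  have m_eq: "m = (\<lambda>u. (u + a) / (1 + cnj a * u))"
    by (simp add: m_def Moebius_function_simple fun_eq_iff)
  have "of_real (1 - (cmod a)\<^sup>2) = 1 - a * cnj a"
    unfolding of_real_diff complex_norm_square by simp
  then have dm: "(m has_field_derivative of_real (1 - (cmod a)\<^sup>2)) (at 0)"
    unfolding m_eq by (auto intro!: derivative_eq_intros)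
  have d\<sigma>: "(\<sigma> has_field_derivative deriv \<sigma> a) (at (m 0))"
    unfolding m0 by (rule holomorphic_derivI[OF hol _ a]) simp
  have "(\<sigma> \<circ> m) holomorphic_on ball 0 1"
    by (rule holomorphic_on_compose_gen[OF m_hol hol]) (use m_in in auto)
  then have "cmod (deriv (\<sigma> \<circ> m) 0) \<le> 2 * cmod ((\<sigma> \<circ> m) 0)"
    by (rule deriv_zero_bound_of_no_opposite_values) (use opp m_in in auto)
  moreover have "deriv (\<sigma> \<circ> m) 0 = deriv \<sigma> a * of_real (1 - (cmod a)\<^sup>2)"
    by (intro DERIV_imp_deriv DERIV_chain d\<sigma> dm)
  moreover have "cmod (of_real (1 - (cmod a)\<^sup>2)) = 1 - (cmod a)\<^sup>2"
    using a by (subst norm_of_real) (simp add: abs_square_le_1)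
  ultimately show ?thesis
    by (simp only: norm_mult o_def m0)
qed

text \<open>
  Integrate the bound \<open>\<bar>\<sigma>'/\<sigma>\<bar> \<le> 2 / (1 - t\<^sup>2)\<close> along the radius to \<open>z\<close>; the right-hand side is the
  derivative of \<open>ln ((1 + t) / (1 - t))\<close>.
\<close>
lemma growth_of_no_opposite_values:
  assumes hol: "\<sigma> holomorphic_on ball 0 1"
    and opp: "\<And>z w. z \<in> ball 0 1 \<Longrightarrow> w \<in> ball 0 1 \<Longrightarrow> \<sigma> z + \<sigma> w \<noteq> 0"
    and z: "z \<in> ball 0 1"
  shows "cmod (\<sigma> z) \<le> cmod (\<sigma> 0) * ((1 + cmod z) / (1 - cmod z))"
proof (cases "z = 0")
  case False
  have nz: "\<sigma> w \<noteq> 0" if "w \<in> ball 0 1" for w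
    using opp[OF that that] by auto
  obtain l where l_hol: "l holomorphic_on ball 0 1" and l: "\<And>w. w \<in> ball 0 1 \<Longrightarrow> \<sigma> w = exp (l w)"
    using contractible_imp_holomorphic_log[OF hol convex_imp_contractible[OF convex_ball] nz] by blast
  define u where "u = sgn z"
  have u: "cmod u = 1" "z = of_real (cmod z) * u"
  proof -
    show "cmod u = 1" unfolding u_def norm_sgn using False by simp
    show "z = of_real (cmod z) * u" unfolding u_def sgn_eq using False by simp
  qed
  define F where "F t = Re (l (of_real t * u)) - (ln (1 + t) - ln (1 - t))" for t
  have "F (cmod z) \<le> F 0"
  proof (rule DERIV_nonpos_imp_nonincreasing[where f = F])
    fix t assume t: "0 \<le> t" "t \<le> cmod z"
    have tz: "t < 1" using t z by simp
    have w: "of_real t * u \<in> ball 0 1" using t tz u by (simp add: norm_mult)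
    have dl: "(l has_field_derivative deriv l (of_real t * u)) (at (of_real t * u))"
      by (rule holomorphic_derivI[OF l_hol _ w]) simp
    have "(\<sigma> has_field_derivative exp (l (of_real t * u)) * deriv l (of_real t * u)) (at (of_real t * u))"
    proof (rule has_field_derivative_transform_within_open[where S = "ball 0 1"])
      show "((\<lambda>w. exp (l w)) has_field_derivative exp (l (of_real t * u)) * deriv l (of_real t * u)) (at (of_real t * u))"
        by (auto intro!: derivative_eq_intros dl)
    qed (use w l in auto)
    then have "deriv \<sigma> (of_real t * u) = \<sigma> (of_real t * u) * deriv l (of_real t * u)"
      using l[OF w] by (simp add: DERIV_imp_deriv)
    moreover have "cmod (of_real t * u) = t" using t u by (simp add: norm_mult)
    ultimately have "cmod (deriv l (of_real t * u)) * (1 - t\<^sup>2) \<le> 2"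
      using deriv_bound_of_no_opposite_values[OF hol opp w] nz[OF w] by (simp add: norm_mult)
    moreover have "1 - t\<^sup>2 > 0" using t tz by (simp add: abs_square_less_1)
    ultimately have bound: "cmod (deriv l (of_real t * u)) \<le> 2 / (1 - t\<^sup>2)"
      by (simp add: pos_le_divide_eq)
    have "((\<lambda>x. l (of_real x * u)) has_vector_derivative deriv l (of_real t * u) * u) (at t)"
    proof -
      have "((\<lambda>x. l (x * u)) has_field_derivative deriv l (of_real t * u) * u) (at (of_real t))"
        by (rule DERIV_chain2[of l _ "\<lambda>x. x * u" "of_real t", OF dl]) (auto intro!: derivative_eq_intros)
      then show ?thesis by (rule has_vector_derivative_real_field)
    qed
    then have "((\<lambda>x. Re (l (of_real x * u))) has_vector_derivative Re (deriv l (of_real t * u) * u)) (at t)"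
      by (rule bounded_linear.has_vector_derivative[OF bounded_linear_Re])
    then have dRe: "((\<lambda>x. Re (l (of_real x * u))) has_real_derivative Re (deriv l (of_real t * u) * u)) (at t)"
      by (simp add: has_real_derivative_iff_has_vector_derivative)
    have "(F has_real_derivative Re (deriv l (of_real t * u) * u) - (1 / (1 + t) + 1 / (1 - t))) (at t)"
      unfolding F_def
    proof (rule DERIV_diff[OF dRe])
      show "((\<lambda>t. ln (1 + t) - ln (1 - t)) has_real_derivative 1 / (1 + t) + 1 / (1 - t)) (at t)"
        using t tz by (auto intro!: derivative_eq_intros)
    qed
    moreover have "Re (deriv l (of_real t * u) * u) \<le> 1 / (1 + t) + 1 / (1 - t)"
    proof -
      have "Re (deriv l (of_real t * u) * u) \<le> cmod (deriv l (of_real t * u) * u)"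
        by (rule complex_Re_le_cmod)
      also have "\<dots> \<le> 2 / (1 - t\<^sup>2)" using bound u by (simp add: norm_mult)
      also have "\<dots> = 1 / (1 + t) + 1 / (1 - t)"
      proof -
        have "1 - t\<^sup>2 = (1 + t) * (1 - t)"
          by (simp add: power2_eq_square algebra_simps)
        moreover have "1 + t \<noteq> 0" "1 - t \<noteq> 0" using t tz by auto
        ultimately show ?thesis by (simp add: add_frac_eq)
      qed
      finally show ?thesis .
    qed
    ultimately show "\<exists>y. (F has_real_derivative y) (at t) \<and> y \<le> 0" by force
  qed simp
  then have "Re (l z) \<le> Re (l 0) + ln ((1 + cmod z) / (1 - cmod z))"
  proof -
    have "1 + cmod z > 0" "1 - cmod z > 0" using z by (auto intro: add_pos_nonneg)
    then have "ln ((1 + cmod z) / (1 - cmod z)) = ln (1 + cmod z) - ln (1 - cmod z)"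
      by (simp add: ln_div)
    then show ?thesis
      using \<open>F (cmod z) \<le> F 0\<close> u(2)[symmetric] by (simp add: F_def)
  qed
  then have "exp (Re (l z)) \<le> exp (Re (l 0) + ln ((1 + cmod z) / (1 - cmod z)))" by simp
  also have "\<dots> = exp (Re (l 0)) * ((1 + cmod z) / (1 - cmod z))"
    using z by (subst exp_add, subst exp_ln) (auto intro!: divide_pos_pos add_pos_nonneg)
  finally show ?thesis
    using l[of z] l[of 0] z by simp
qed simp

text \<open>
  A branch \<open>\<sigma>\<close> of \<open>\<surd>(1 - f/c)\<close> never takes opposite values: \<open>\<sigma> v = - \<sigma> w\<close> forces
  \<open>f v = f w\<close>, hence \<open>v = w\<close> and \<open>\<sigma> v = 0\<close>, although \<open>f\<close> omits \<open>c\<close>. When \<open>f\<close> is a Koebe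
  function, the bound exceeds the true growth only by \<open>2 \<bar>c\<bar>\<close>, which is negligible as \<open>\<bar>z\<bar>\<close>
  tends to \<open>1\<close>.
\<close>
lemma growth_of_univalent_omitting:
  assumes hol: "f holomorphic_on ball 0 1" and inj: "inj_on f (ball 0 1)"
    and f0: "f 0 = 0" and omit: "\<And>z. z \<in> ball 0 1 \<Longrightarrow> f z \<noteq> c"
    and z: "z \<in> ball 0 1"
  shows "cmod (f z) \<le> cmod c * (1 + ((1 + cmod z) / (1 - cmod z))\<^sup>2)"
proof -
  have c: "c \<noteq> 0" using omit[of 0] f0 by auto
  have "(\<lambda>w. 1 - f w / c) holomorphic_on ball 0 1"
    using c by (intro holomorphic_intros hol) auto
  moreover have "1 - f w / c \<noteq> 0" if "w \<in> ball 0 1" for w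
    using omit[OF that] c by (auto simp: field_simps)
  ultimately obtain \<sigma> where \<sigma>_hol: "\<sigma> holomorphic_on ball 0 1"
    and \<sigma>: "\<And>w. w \<in> ball 0 1 \<Longrightarrow> 1 - f w / c = (\<sigma> w)\<^sup>2"
    by (rule contractible_imp_holomorphic_sqrt[OF _ convex_imp_contractible[OF convex_ball]]) blast+
  have "\<sigma> v + \<sigma> w \<noteq> 0" if "v \<in> ball 0 1" "w \<in> ball 0 1" for v w
  proof
    assume *: "\<sigma> v + \<sigma> w = 0"
    then have "(\<sigma> v)\<^sup>2 = (\<sigma> w)\<^sup>2" by (simp add: add_eq_0_iff)
    then have "f v / c = f w / c"
      using \<sigma>[OF that(1)] \<sigma>[OF that(2)] by (metis add_diff_cancel_left' diff_add_cancel diff_diff_eq2)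
    then have "f v = f w" using c by simp
    then have "v = w" using inj that by (meson inj_onD)
    then have "\<sigma> v = 0" using * by simp
    then show False using \<sigma>[OF that(1)] omit[OF that(1)] c by (simp add: field_simps)
  qed
  then have "cmod (\<sigma> z) \<le> cmod (\<sigma> 0) * ((1 + cmod z) / (1 - cmod z))"
    by (intro growth_of_no_opposite_values[OF \<sigma>_hol _ z]) auto
  moreover have "cmod (\<sigma> 0) = 1"
    using \<sigma>[of 0] f0 by (metis centre_in_ball diff_zero div_0 norm_one norm_power power_eq_1_iff zero_less_one norm_ge_zero zero_neq_numeral)
  ultimately have "(cmod (\<sigma> z))\<^sup>2 \<le> ((1 + cmod z) / (1 - cmod z))\<^sup>2"
    by (intro power_mono) auto
  moreover have "f z = c * (1 - (\<sigma> z)\<^sup>2)"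
    using \<sigma>[OF z] c by (simp add: field_simps)
  moreover have "cmod (1 - (\<sigma> z)\<^sup>2) \<le> 1 + (cmod (\<sigma> z))\<^sup>2"
    by (metis norm_one norm_power norm_triangle_ineq4)
  ultimately show ?thesis
    by (simp add: norm_mult mult_left_mono)
qed

section \<open>Inverse branches of polynomials\<close>

lemma poly_is_holomorphic: "poly p holomorphic_on S" for p :: "complex poly"
  using poly_holomorphic_on[OF holomorphic_on_ident] by simp

lemma section_deriv_nonzero:
  assumes "g holomorphic_on S" "open S" "\<And>x. x \<in> S \<Longrightarrow> poly p (g x) = x" "a \<in> S"
  shows "poly (pderiv p) (g a) \<noteq> 0"
proof -
  have dg: "(g has_field_derivative deriv g a) (at a)"
    by (rule holomorphic_derivI[OF assms(1,2,4)])
  have "((\<lambda>x. poly p (g x)) has_field_derivative poly (pderiv p) (g a) * deriv g a) (at a)"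
    by (rule DERIV_chain2[OF poly_DERIV dg])
  moreover have "((\<lambda>x. poly p (g x)) has_field_derivative 1) (at a)"
    by (rule has_field_derivative_transform_within_open[OF DERIV_ident assms(2,4)]) (simp add: assms(3))
  ultimately have "poly (pderiv p) (g a) * deriv g a = 1"
    by (rule DERIV_unique)
  then show ?thesis by auto
qed

lemma poly_locally_injective:
  fixes a :: complex
  assumes "poly (pderiv p) a \<noteq> 0"
  obtains \<rho> where "\<rho> > 0" "inj_on (poly p) (ball a \<rho>)"
proof -
  have "deriv (poly p) a = poly (pderiv p) a"
    by (rule DERIV_imp_deriv[OF poly_DERIV])
  then show ?thesis
    using has_complex_derivative_locally_injective[OF poly_is_holomorphic UNIV_I open_UNIV, of p a] assms that
    by metis
qed

text \<open>
  A right inverse of \<open>p\<close> avoids the critical points, so near a common value of two of them \<open>p\<close> is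
  injective and they agree on a neighbourhood; the identity theorem does the rest.
\<close>
lemma section_unique:
  assumes g: "g holomorphic_on S" "\<And>x. x \<in> S \<Longrightarrow> poly p (g x) = x"
    and h: "h holomorphic_on S" "\<And>x. x \<in> S \<Longrightarrow> poly p (h x) = x"
    and S: "open S" "connected S" and a: "a \<in> S" "g a = h a" and x: "x \<in> S"
  shows "g x = h x"
proof -
  obtain \<rho> where \<rho>: "\<rho> > 0" "inj_on (poly p) (ball (g a) \<rho>)"
    using poly_locally_injective section_deriv_nonzero[OF g(1) S(1) g(2) a(1)] by blast
  define U where "U = (S \<inter> g -` ball (g a) \<rho>) \<inter> (S \<inter> h -` ball (g a) \<rho>)"
  have "open U"
    unfolding U_def using g(1) h(1) S(1)
    by (intro open_Int continuous_open_preimage holomorphic_on_imp_continuous_on open_ball)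
  moreover have "a \<in> U" using a \<rho> by (auto simp: U_def)
  moreover have "g y = h y" if "y \<in> U" for y
  proof (rule inj_onD[OF \<rho>(2)])
    show "poly p (g y) = poly p (h y)" using that g(2) h(2) by (auto simp: U_def)
  qed (use that in \<open>auto simp: U_def\<close>)
  ultimately show ?thesis
  proof -
    assume U: "open U" "a \<in> U" and eq: "\<And>y. y \<in> U \<Longrightarrow> g y = h y"
    show ?thesis
      by (rule analytic_continuation_open[OF U(1) S(1) _ S(2) _ g(1) h(1) eq x])
         (use U(2) in \<open>auto simp: U_def\<close>)
  qed
qed

definition inverse_branch :: "complex poly \<Rightarrow> real \<Rightarrow> (complex \<Rightarrow> complex) \<Rightarrow> bool"
  where "inverse_branch p r \<phi> \<longleftrightarrow>
    \<phi> holomorphic_on ball 0 r \<and> \<phi> 0 = 0 \<and> (\<forall>\<xi>\<in>ball 0 r. poly p (\<phi> \<xi>) = \<xi>)"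

lemma inverse_branchD:
  assumes "inverse_branch p r \<phi>"
  shows "\<phi> holomorphic_on ball 0 r" "\<phi> 0 = 0" "\<And>\<xi>. \<xi> \<in> ball 0 r \<Longrightarrow> poly p (\<phi> \<xi>) = \<xi>"
  using assms by (auto simp: inverse_branch_def)

lemma inverse_branch_from_injectivity:
  assumes "open W" "0 \<in> W" "inj_on (poly p) W" "poly p 0 = 0" "ball 0 r \<subseteq> poly p ` W"
  shows "\<exists>\<phi>. inverse_branch p r \<phi>"
proof -
  obtain g where g: "g holomorphic_on (poly p ` W)"
      "\<And>z. z \<in> W \<Longrightarrow> deriv (poly p) z * deriv g (poly p z) = 1"
      "\<And>z. z \<in> W \<Longrightarrow> g (poly p z) = z"
    using holomorphic_has_inverse[OF poly_is_holomorphic assms(1,3)] by metis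
  have "inverse_branch p r g"
    unfolding inverse_branch_def
  proof (intro conjI ballI)
    show "g holomorphic_on ball 0 r" by (rule holomorphic_on_subset[OF g(1) assms(5)])
    show "g 0 = 0" using g(3)[OF assms(2)] assms(4) by simp
    fix \<xi> :: complex assume "\<xi> \<in> ball 0 r"
    then obtain w where "w \<in> W" "\<xi> = poly p w" using assms(5) by blast
    then show "poly p (g \<xi>) = \<xi>" using g(3) by simp
  qed
  then show ?thesis by blast
qed

text \<open>
  If \<open>p\<close> maps a disc \<open>S\<close> containing both \<open>0\<close> and the critical point \<open>\<zeta>\<close> into the domain of
  \<open>\<phi>\<close>, then \<open>\<phi> \<circ> p\<close> is the identity near \<open>0\<close> and therefore on \<open>S\<close>, so \<open>p'\<close> cannot vanish at \<open>\<zeta>\<close>.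
\<close>
lemma inverse_branch_radius_bounded:
  assumes p0: "poly p 0 = 0" and p'0: "poly (pderiv p) 0 \<noteq> 0" and crit: "poly (pderiv p) \<zeta> = 0"
  shows "\<exists>R. \<forall>r \<phi>. inverse_branch p r \<phi> \<longrightarrow> r \<le> R"
proof -
  define S where "S = ball (0::complex) (cmod \<zeta> + 1)"
  have "compact (poly p ` cball 0 (cmod \<zeta> + 1))"
    by (intro compact_continuous_image continuous_intros compact_cball)
  then obtain R where R0: "\<forall>y\<in>poly p ` cball 0 (cmod \<zeta> + 1). cmod y \<le> R"
    using compact_imp_bounded bounded_iff by blast
  have R: "cmod (poly p z) \<le> R" if "z \<in> S" for z
    using R0 that by (auto simp: S_def)
  have "r \<le> R" if br: "inverse_branch p r \<phi>" for r \<phi>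
  proof (rule ccontr)
    assume "\<not> r \<le> R"
    then have into: "poly p z \<in> ball 0 r" if "z \<in> S" for z
      using R[OF that] by simp
    note \<phi> = inverse_branchD[OF br]
    have comp: "(\<lambda>z. \<phi> (poly p z)) holomorphic_on S"
      using holomorphic_on_compose_gen[OF poly_is_holomorphic \<phi>(1), of p S] into
      by (auto simp: o_def image_subset_iff)
    have zS: "0 \<in> S" "\<zeta> \<in> S" "open S" "connected S" by (auto simp: S_def add_nonneg_pos)
    obtain \<rho> where \<rho>: "\<rho> > 0" "inj_on (poly p) (ball 0 \<rho>)"
      using poly_locally_injective[OF p'0] by blast
    define U where "U = (S \<inter> (\<lambda>z. \<phi> (poly p z)) -` ball 0 \<rho>) \<inter> ball 0 \<rho>"
    have "open U"
      unfolding U_def using comp zS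
      by (intro open_Int continuous_open_preimage holomorphic_on_imp_continuous_on open_ball)
    moreover have "0 \<in> U" using zS \<rho> \<phi>(2) p0 by (auto simp: U_def)
    moreover have "\<phi> (poly p y) = y" if "y \<in> U" for y
    proof (rule inj_onD[OF \<rho>(2)])
      show "poly p (\<phi> (poly p y)) = poly p y" using that into by (intro \<phi>(3)) (auto simp: U_def)
    qed (use that in \<open>auto simp: U_def\<close>)
    ultimately have id: "\<phi> (poly p z) = z" if "z \<in> S" for z
    proof -
      assume U: "open U" "0 \<in> U" and eq: "\<And>y. y \<in> U \<Longrightarrow> \<phi> (poly p y) = y"
      show ?thesis
        by (rule analytic_continuation_open[OF U(1) zS(3) _ zS(4) _ comp holomorphic_on_ident eq that])
           (use U(2) in \<open>auto simp: U_def\<close>)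
    qed
    have "(\<phi> has_field_derivative deriv \<phi> (poly p \<zeta>)) (at (poly p \<zeta>))"
      by (rule holomorphic_derivI[OF \<phi>(1) open_ball into[OF zS(2)]])
    then have "((\<lambda>z. \<phi> (poly p z)) has_field_derivative deriv \<phi> (poly p \<zeta>) * poly (pderiv p) \<zeta>) (at \<zeta>)"
      by (rule DERIV_chain2[of \<phi> _ "poly p"]) (rule poly_DERIV)
    moreover have "((\<lambda>z. \<phi> (poly p z)) has_field_derivative 1) (at \<zeta>)"
      by (rule has_field_derivative_transform_within_open[OF DERIV_ident zS(3,2)]) (simp add: id)
    ultimately show False using crit DERIV_unique by fastforce
  qed
  then show ?thesis by blast
qed

text \<open>
  Branches on different discs agree where both are defined, so they can be glued to a branch on
  the disc whose radius is the supremum.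
\<close>
lemma maximal_inverse_branch:
  assumes p0: "poly p 0 = 0" and p'0: "poly (pderiv p) 0 \<noteq> 0" and crit: "poly (pderiv p) \<zeta> = 0"
  obtains r \<phi> where "r > 0" "inverse_branch p r \<phi>" "\<And>s \<psi>. inverse_branch p s \<psi> \<Longrightarrow> s \<le> r"
proof -
  define A where "A = {r. r > 0 \<and> (\<exists>\<phi>. inverse_branch p r \<phi>)}"
  have bdd: "bdd_above A"
    using inverse_branch_radius_bounded[OF assms] by (auto simp: A_def bdd_above_def)
  obtain \<rho> where \<rho>: "\<rho> > 0" "inj_on (poly p) (ball 0 \<rho>)"
    using poly_locally_injective[OF p'0] by blast
  have "open (poly p ` ball 0 \<rho>)"
    by (rule open_mapping_thm3[OF poly_is_holomorphic open_ball \<rho>(2)])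
  moreover have "0 \<in> poly p ` ball 0 \<rho>" using p0 \<rho>(1) by (metis centre_in_ball image_eqI)
  ultimately obtain s where s: "s > 0" "ball 0 s \<subseteq> poly p ` ball 0 \<rho>"
    using open_contains_ball by blast
  then have sA: "s \<in> A"
    using inverse_branch_from_injectivity[OF open_ball _ \<rho>(2) p0, of s] \<rho> by (auto simp: A_def)
  define r where "r = Sup A"
  have r0: "r > 0" using cSup_upper[OF sA bdd] s by (simp add: r_def)
  have "\<forall>t\<in>A. \<exists>\<phi>. inverse_branch p t \<phi>" by (simp add: A_def)
  from bchoice[OF this] obtain \<psi> where \<psi>: "\<And>t. t \<in> A \<Longrightarrow> inverse_branch p t (\<psi> t)"
    by blast
  have agree: "\<psi> t x = \<psi> u x" if "t \<in> A" "u \<in> A" "x \<in> ball 0 t" "x \<in> ball 0 u" for t u x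
  proof (rule section_unique[of "\<psi> t" "ball 0 (min t u)" p "\<psi> u" 0])
    note d = inverse_branchD[OF \<psi>[OF that(1)]] inverse_branchD[OF \<psi>[OF that(2)]]
    show "\<psi> t holomorphic_on ball 0 (min t u)" "\<psi> u holomorphic_on ball 0 (min t u)"
      using d(1,4) by (auto elim!: holomorphic_on_subset)
    show "poly p (\<psi> t x) = x" "poly p (\<psi> u x) = x" if "x \<in> ball 0 (min t u)" for x
      using d(3)[of x] d(6)[of x] that by auto
    show "\<psi> t 0 = \<psi> u 0" using d(2,5) by simp
    show "0 \<in> ball 0 (min t u)" using that(1,2) by (auto simp: A_def)
  qed (use that in auto)
  define sel where "sel x = (SOME t. t \<in> A \<and> x \<in> ball 0 t)" for x :: complex
  define \<phi> where "\<phi> x = \<psi> (sel x) x" for x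
  have sel: "sel x \<in> A \<and> x \<in> ball 0 (sel x)" if "x \<in> ball 0 r" for x
  proof -
    have "\<exists>t\<in>A. cmod x < t"
      using that sA bdd by (intro less_cSupD) (auto simp: r_def)
    then show ?thesis
      using someI_ex[of "\<lambda>t. t \<in> A \<and> x \<in> ball 0 t"] by (auto simp: sel_def)
  qed
  have sub: "ball 0 t \<subseteq> (ball 0 r :: complex set)" if "t \<in> A" for t
    using cSup_upper[OF that bdd] by (auto simp: r_def)
  have \<phi>_eq: "\<phi> x = \<psi> t x" if "t \<in> A" "x \<in> ball 0 t" for t x
    unfolding \<phi>_def using sel[of x] sub[OF that(1)] that by (intro agree) auto
  have "inverse_branch p r \<phi>"
    unfolding inverse_branch_def
  proof (intro conjI ballI)
    show "\<phi> holomorphic_on ball 0 r"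
      unfolding holomorphic_on_open[OF open_ball]
    proof
      fix x :: complex assume x: "x \<in> ball 0 r"
      have "(\<psi> (sel x) has_field_derivative deriv (\<psi> (sel x)) x) (at x)"
        using sel[OF x] \<psi> by (intro holomorphic_derivI[OF inverse_branchD(1)]) auto
      then have "(\<phi> has_field_derivative deriv (\<psi> (sel x)) x) (at x)"
        by (rule has_field_derivative_transform_within_open[OF _ open_ball[of 0 "sel x"]])
           (use sel[OF x] \<phi>_eq in auto)
      then show "\<exists>f'. (\<phi> has_field_derivative f') (at x)" ..
    qed
    show "\<phi> 0 = 0" using \<phi>_eq[OF sA, of 0] inverse_branchD(2)[OF \<psi>[OF sA]] s by simp
    show "poly p (\<phi> x) = x" if "x \<in> ball 0 r" for x
      using sel[OF that] \<phi>_eq inverse_branchD(3)[OF \<psi>] by metis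
  qed
  moreover have "s \<le> r" if "inverse_branch p s \<psi>" for s \<psi>
  proof (cases "s > 0")
    case True
    then show ?thesis
      using that cSup_upper[OF _ bdd, of s] by (auto simp: A_def r_def)
  qed (use r0 in linarith)
  ultimately show ?thesis using that r0 by blast
qed

text \<open>
  Pairs violating injectivity closer and closer to \<open>K\<close> would accumulate at a pair of points of \<open>K\<close>
  with the same value, that is, at a single point of \<open>K\<close>; there local injectivity is violated.
\<close>
lemma injective_near_compact:
  fixes K :: "complex set"
  assumes K: "compact K" and inj: "inj_on (poly p) K" and nz: "\<And>a. a \<in> K \<Longrightarrow> poly (pderiv p) a \<noteq> 0"
  obtains \<delta> where "\<delta> > 0" "inj_on (poly p) (\<Union>a\<in>K. ball a \<delta>)"
proof (rule ccontr)
  assume "\<not> thesis"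
  then have no: "\<not> inj_on (poly p) (\<Union>a\<in>K. ball a (inverse (real (Suc n))))" for n
    using that[of "inverse (real (Suc n))"] by auto
  have "\<exists>x y a b. x \<noteq> y \<and> poly p x = poly p y \<and> a \<in> K \<and> b \<in> K \<and>
          dist a x < inverse (real (Suc n)) \<and> dist b y < inverse (real (Suc n))" for n
    using no[of n] unfolding inj_on_def by (auto simp del: of_nat_Suc) blast
  then obtain x y a b where
    xy: "\<And>n. x n \<noteq> y n" "\<And>n. poly p (x n) = poly p (y n)" and
    ab: "\<And>n. a n \<in> K" "\<And>n. b n \<in> K" and
    d: "\<And>n. dist (a n) (x n) < inverse (real (Suc n))" "\<And>n. dist (b n) (y n) < inverse (real (Suc n))"
    by metis
  have "\<forall>n. (a n, b n) \<in> K \<times> K" using ab by auto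
  moreover have "seq_compact (K \<times> K)"
    using K compact_Times compact_imp_seq_compact by blast
  ultimately obtain l u where l: "l \<in> K \<times> K" "strict_mono (u::nat \<Rightarrow> nat)" "((\<lambda>n. (a n, b n)) \<circ> u) \<longlonglongrightarrow> l"
    unfolding seq_compact_def by meson
  define la lb where "la = fst l" and "lb = snd l"
  have la: "(\<lambda>n. a (u n)) \<longlonglongrightarrow> la" "(\<lambda>n. b (u n)) \<longlonglongrightarrow> lb"
    using tendsto_fst[OF l(3)] tendsto_snd[OF l(3)] by (auto simp: o_def la_def lb_def)
  have inv: "(\<lambda>n. inverse (real (Suc (u n)))) \<longlonglongrightarrow> 0"
    using LIMSEQ_subseq_LIMSEQ[OF LIMSEQ_inverse_real_of_nat l(2)] by (simp add: o_def)
  have xl: "(\<lambda>n. x (u n)) \<longlonglongrightarrow> la"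
  proof (rule Lim_transform[OF la(1)])
    show "(\<lambda>n. x (u n) - a (u n)) \<longlonglongrightarrow> 0"
      using d(1) by (intro Lim_null_comparison[OF _ inv] always_eventually allI) (simp add: dist_norm norm_minus_commute less_imp_le)
  qed
  have yl: "(\<lambda>n. y (u n)) \<longlonglongrightarrow> lb"
  proof (rule Lim_transform[OF la(2)])
    show "(\<lambda>n. y (u n) - b (u n)) \<longlonglongrightarrow> 0"
      using d(2) by (intro Lim_null_comparison[OF _ inv] always_eventually allI) (simp add: dist_norm norm_minus_commute less_imp_le)
  qed
  have "(\<lambda>n. poly p (x (u n))) \<longlonglongrightarrow> poly p la" "(\<lambda>n. poly p (y (u n))) \<longlonglongrightarrow> poly p lb"
    using xl yl by (auto intro: tendsto_intros)
  then have pl: "poly p la = poly p lb"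
    using xy(2) LIMSEQ_unique by simp
  have lK: "la \<in> K" "lb \<in> K" using l(1) by (auto simp: la_def lb_def)
  have eq: "la = lb" by (rule inj_onD[OF inj pl lK])
  obtain \<rho> where \<rho>: "\<rho> > 0" "inj_on (poly p) (ball la \<rho>)"
    using poly_locally_injective nz[OF lK(1)] by blast
  have "\<forall>\<^sub>F n in sequentially. x (u n) \<in> ball la \<rho>"
    by (rule topological_tendstoD[OF xl open_ball]) (use \<rho>(1) in simp)
  moreover have "\<forall>\<^sub>F n in sequentially. y (u n) \<in> ball la \<rho>"
    by (rule topological_tendstoD[OF yl open_ball]) (use \<rho>(1) eq in simp)
  ultimately have "\<forall>\<^sub>F n in sequentially. False"
  proof eventually_elim
    case (elim n)
    then have "x (u n) = y (u n)"
      by (intro inj_onD[OF \<rho>(2) xy(2)])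
    then show False using xy(1) by blast
  qed
  then show False by simp
qed

lemma bounded_poly_sublevel:
  fixes p :: "complex poly"
  assumes "degree p > 0"
  shows "bounded {z. cmod (poly p z) \<le> r}"
proof -
  have "filterlim (poly p) at_infinity at_infinity"
    using assms by (rule filterlim_poly_at_infinity)
  moreover have "max r 0 + 1 > 0" by simp
  ultimately have "\<forall>\<^sub>F z in at_infinity. max r 0 + 1 \<le> cmod (poly p z)"
    by (simp add: filterlim_at_infinity[of 0])
  then obtain b where b: "\<And>z. b \<le> cmod z \<Longrightarrow> max r 0 + 1 \<le> cmod (poly p z)"
    unfolding eventually_at_infinity by blast
  have "cmod z \<le> b" if "cmod (poly p z) \<le> r" for z
    using b[of z] that by linarith
  then show ?thesis by (auto simp: bounded_iff)
qed

text \<open>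
  Take the inverse branch on the largest disc. If along every radius it accumulated only at
  points where \<open>p'\<close> does not vanish, local inverses of \<open>p\<close> at these points would continue it to
  the closed disc, \<open>p\<close> would be injective on the compact closure \<open>K\<close> of its image and then on a
  neighbourhood of \<open>K\<close>, and the inverse there would live on a larger disc.
\<close>
lemma critical_point_on_ray:
  assumes p0: "poly p 0 = 0" and p'0: "poly (pderiv p) 0 \<noteq> 0" and crit: "poly (pderiv p) \<zeta> = 0"
  obtains r \<phi> \<xi> \<omega> where "r > 0" "inverse_branch p r \<phi>" "cmod \<xi> = r" "poly (pderiv p) \<omega> = 0"
    "\<omega> \<in> closure ((\<lambda>t. \<phi> (of_real t * \<xi>)) ` {0<..<1})"
proof -
  obtain r \<phi> where r: "r > 0" and br: "inverse_branch p r \<phi>"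
    and maximal: "\<And>s \<psi>. inverse_branch p s \<psi> \<Longrightarrow> s \<le> r"
    using maximal_inverse_branch[OF assms] by blast
  note \<phi> = inverse_branchD[OF br]
  define ray where "ray \<xi> = (\<lambda>t. \<phi> (of_real t * \<xi>)) ` {0<..<1}" for \<xi>
  have "\<exists>\<xi> \<omega>. cmod \<xi> = r \<and> poly (pderiv p) \<omega> = 0 \<and> \<omega> \<in> closure (ray \<xi>)"
  proof (rule ccontr)
    assume "\<not> ?thesis"
    then have regular: "poly (pderiv p) \<omega> \<noteq> 0" if "cmod \<xi> = r" "\<omega> \<in> closure (ray \<xi>)" for \<xi> \<omega>
      using that by blast
    define K where "K = closure (\<phi> ` ball 0 r)"
    have "degree p > 0"
      using p'0 by (metis gr0I pderiv_eq_0_iff poly_0)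
    then have "bounded {z. cmod (poly p z) \<le> r}" by (rule bounded_poly_sublevel)
    moreover have "\<phi> ` ball 0 r \<subseteq> {z. cmod (poly p z) \<le> r}"
      using \<phi>(3) by (auto simp: less_imp_le)
    ultimately have K: "compact K"
      unfolding K_def compact_closure by (rule bounded_subset)
    have on_ball: "of_real t * \<xi> \<in> ball 0 r" if "cmod \<xi> = r" "0 \<le> t" "t < 1" for t \<xi>
      using that r by (simp add: norm_mult)
    have cont: "continuous_on (ball 0 r) \<phi>"
      by (rule holomorphic_on_imp_continuous_on[OF \<phi>(1)])
    \<comment> \<open>A radial accumulation point that is not critical is an unrestricted limit: a local inverse of
      \<open>p\<close> there agrees with \<open>\<phi>\<close> at points of the radius, hence on a convex intersection of discs.\<close>
    have lim: "\<exists>z\<in>K. poly (pderiv p) z \<noteq> 0 \<and> poly p z = \<xi> \<and> (\<phi> \<longlongrightarrow> z) (at \<xi> within ball 0 r)"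
      if \<xi>: "cmod \<xi> = r" for \<xi>
    proof -
      define t where "t n = 1 - inverse (real (Suc (Suc n)))" for n
      have t: "0 < t n" "t n < 1" for n by (auto simp: t_def field_simps)
      define \<eta> where "\<eta> n = of_real (t n) * \<xi>" for n
      have \<eta>: "\<eta> n \<in> ball 0 r" for n using on_ball[OF \<xi> less_imp_le[OF t(1)] t(2)] by (simp add: \<eta>_def)
      have "t \<longlonglongrightarrow> 1 - 0"
        unfolding t_def by (intro tendsto_diff tendsto_const LIMSEQ_Suc[OF LIMSEQ_inverse_real_of_nat])
      then have "\<eta> \<longlonglongrightarrow> of_real (1 - 0) * \<xi>"
        unfolding \<eta>_def by (intro tendsto_mult tendsto_of_real tendsto_const)
      then have \<eta>lim: "\<eta> \<longlonglongrightarrow> \<xi>" by simp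
      have "\<forall>n. \<phi> (\<eta> n) \<in> K"
        using \<eta> closure_subset by (fastforce simp: K_def)
      moreover have "seq_compact K" using K compact_imp_seq_compact by blast
      ultimately obtain z u where z: "z \<in> K" "strict_mono (u::nat \<Rightarrow> nat)" "((\<lambda>n. \<phi> (\<eta> n)) \<circ> u) \<longlonglongrightarrow> z"
        unfolding seq_compact_def by meson
      have zlim: "(\<lambda>n. \<phi> (\<eta> (u n))) \<longlonglongrightarrow> z" using z(3) by (simp add: o_def)
      have \<eta>ulim: "(\<lambda>n. \<eta> (u n)) \<longlonglongrightarrow> \<xi>"
        using LIMSEQ_subseq_LIMSEQ[OF \<eta>lim z(2)] by (simp add: o_def)
      have "(\<lambda>n. poly p (\<phi> (\<eta> (u n)))) \<longlonglongrightarrow> poly p z"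
        by (intro tendsto_intros zlim)
      then have pz: "poly p z = \<xi>"
        using LIMSEQ_unique[OF \<eta>ulim] \<phi>(3)[OF \<eta>] by simp
      have "z \<in> closure (ray \<xi>)"
        unfolding closure_sequential using zlim t
        by (intro exI[of _ "\<lambda>n. \<phi> (\<eta> (u n))"]) (auto simp: ray_def \<eta>_def)
      then have nz: "poly (pderiv p) z \<noteq> 0" by (rule regular[OF \<xi>])
      then obtain \<rho> where \<rho>: "\<rho> > 0" "inj_on (poly p) (ball z \<rho>)"
        using poly_locally_injective by blast
      have "open (poly p ` ball z \<rho>)"
        by (rule open_mapping_thm3[OF poly_is_holomorphic open_ball \<rho>(2)])
      moreover have "\<xi> \<in> poly p ` ball z \<rho>" using pz \<rho>(1) by (metis centre_in_ball image_eqI)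
      ultimately obtain \<delta> where \<delta>: "\<delta> > 0" "ball \<xi> \<delta> \<subseteq> poly p ` ball z \<rho>"
        using open_contains_ball by blast
      obtain \<kappa> where \<kappa>: "\<kappa> holomorphic_on (poly p ` ball z \<rho>)"
          "\<And>w. w \<in> ball z \<rho> \<Longrightarrow> deriv (poly p) w * deriv \<kappa> (poly p w) = 1"
          "\<And>w. w \<in> ball z \<rho> \<Longrightarrow> \<kappa> (poly p w) = w"
        using holomorphic_has_inverse[OF poly_is_holomorphic open_ball \<rho>(2)] by metis
      have \<kappa>p: "poly p (\<kappa> x) = x" if "x \<in> ball \<xi> \<delta>" for x
      proof -
        have "x \<in> poly p ` ball z \<rho>" using that \<delta>(2) by blast
        then obtain w where "w \<in> ball z \<rho>" "x = poly p w" by blast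
        then show ?thesis using \<kappa>(3) by simp
      qed
      have \<kappa>hol: "\<kappa> holomorphic_on ball \<xi> \<delta>" by (rule holomorphic_on_subset[OF \<kappa>(1) \<delta>(2)])
      have \<kappa>\<xi>: "\<kappa> \<xi> = z" using \<kappa>(3)[of z] \<rho>(1) pz by simp
      define S where "S = ball 0 r \<inter> ball \<xi> \<delta>"
      have S: "open S" "connected S"
        unfolding S_def by (auto intro!: convex_connected convex_Int)
      have "\<forall>\<^sub>F n in sequentially. \<eta> (u n) \<in> ball \<xi> \<delta>"
        by (rule topological_tendstoD[OF \<eta>ulim open_ball]) (use \<delta>(1) in simp)
      moreover have "\<forall>\<^sub>F n in sequentially. \<phi> (\<eta> (u n)) \<in> ball z \<rho>"
        by (rule topological_tendstoD[OF zlim open_ball]) (use \<rho>(1) in simp)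
      ultimately have "\<forall>\<^sub>F n in sequentially. \<eta> (u n) \<in> S \<and> \<phi> (\<eta> (u n)) = \<kappa> (\<eta> (u n))"
      proof eventually_elim
        case (elim n)
        then have "\<kappa> (poly p (\<phi> (\<eta> (u n)))) = \<phi> (\<eta> (u n))" by (intro \<kappa>(3))
        then show ?case using elim \<phi>(3)[OF \<eta>] \<eta>[of "u n"] by (auto simp: S_def)
      qed
      from eventually_happens'[OF sequentially_bot this]
      obtain a where a: "a \<in> S" "\<phi> a = \<kappa> a" by blast
      have eq: "\<phi> x = \<kappa> x" if "x \<in> S" for x
      proof (rule section_unique[of \<phi> S p \<kappa> a])
        show "\<phi> holomorphic_on S" "\<kappa> holomorphic_on S"
          using \<phi>(1) \<kappa>hol by (auto simp: S_def elim!: holomorphic_on_subset)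
        show "poly p (\<phi> x) = x" "poly p (\<kappa> x) = x" if "x \<in> S" for x
          using \<phi>(3)[of x] \<kappa>p[of x] that by (simp_all add: S_def)
      qed (use S a that in auto)
      have "continuous_on (ball \<xi> \<delta>) \<kappa>" by (rule holomorphic_on_imp_continuous_on[OF \<kappa>hol])
      then have "isCont \<kappa> \<xi>" using \<delta>(1) by (simp add: continuous_on_eq_continuous_at)
      then have "continuous (at \<xi> within ball 0 r) \<kappa>"
        by (rule continuous_at_imp_continuous_at_within)
      then have "(\<kappa> \<longlongrightarrow> z) (at \<xi> within ball 0 r)"
        by (simp add: continuous_within \<kappa>\<xi>)
      moreover have "\<forall>\<^sub>F x in at \<xi> within ball 0 r. \<kappa> x = \<phi> x"
      proof -
        have "\<forall>\<^sub>F x in at \<xi> within ball 0 r. x \<in> ball \<xi> \<delta> \<and> x \<in> ball 0 r"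
          using \<delta>(1) unfolding eventually_at_topological by (intro exI[of _ "ball \<xi> \<delta>"]) auto
        then show ?thesis by eventually_elim (simp add: eq S_def)
      qed
      ultimately have "(\<phi> \<longlongrightarrow> z) (at \<xi> within ball 0 r)"
        by (rule Lim_transform_eventually)
      then show ?thesis using z(1) nz pz by blast
    qed
    have K_cases: "(poly p a \<in> ball 0 r \<and> a = \<phi> (poly p a)) \<or>
        (cmod (poly p a) = r \<and> poly (pderiv p) a \<noteq> 0 \<and> (\<phi> \<longlongrightarrow> a) (at (poly p a) within ball 0 r))"
      if "a \<in> K" for a
    proof -
      from that have "\<exists>y. (\<forall>n. y n \<in> \<phi> ` ball 0 r) \<and> y \<longlonglongrightarrow> a"
        unfolding K_def closure_sequential .
      then obtain y where y: "\<forall>n. y n \<in> \<phi> ` ball 0 r" "y \<longlonglongrightarrow> a" by blast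
      from y(1) have "\<forall>n. \<exists>x. x \<in> ball 0 r \<and> y n = \<phi> x" by blast
      from choice[OF this] obtain x where x: "\<And>n. x n \<in> ball 0 r" "\<And>n. y n = \<phi> (x n)"
        by blast
      have "y = (\<lambda>n. \<phi> (x n))" using x(2) by (rule ext)
      with y(2) have ylim: "(\<lambda>n. \<phi> (x n)) \<longlonglongrightarrow> a" by simp
      have "(\<lambda>n. poly p (\<phi> (x n))) \<longlonglongrightarrow> poly p a" by (intro tendsto_intros ylim)
      then have xlim: "x \<longlonglongrightarrow> poly p a" using \<phi>(3)[OF x(1)] by simp
      have le: "cmod (poly p a) \<le> r"
        by (rule LIMSEQ_le_const2[OF tendsto_norm[OF xlim]]) (use x(1) in \<open>auto intro: less_imp_le\<close>)
      show ?thesis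
      proof (cases "cmod (poly p a) = r")
        case True
        obtain z where z: "poly (pderiv p) z \<noteq> 0" "(\<phi> \<longlongrightarrow> z) (at (poly p a) within ball 0 r)"
          using lim[OF True] by blast
        have "x n \<noteq> poly p a" for n
          using x(1)[of n] True by auto
        then have "filterlim x (at (poly p a) within ball 0 r) sequentially"
          unfolding filterlim_at using xlim x(1) by (auto intro!: always_eventually)
        then have "(\<lambda>n. \<phi> (x n)) \<longlonglongrightarrow> z" by (rule filterlim_compose[OF z(2)])
        then have "z = a" using ylim LIMSEQ_unique by blast
        then show ?thesis using z True by blast
      next
        case False
        then have pin: "poly p a \<in> ball 0 r" using le by simp
        then have "isCont \<phi> (poly p a)"
          using cont by (simp add: continuous_on_eq_continuous_at)
        then have "(\<lambda>n. \<phi> (x n)) \<longlonglongrightarrow> \<phi> (poly p a)"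
          using xlim by (rule isCont_tendsto_compose)
        then have "\<phi> (poly p a) = a" using ylim by (rule LIMSEQ_unique)
        then show ?thesis using pin by simp
      qed
    qed
    have nzK: "poly (pderiv p) a \<noteq> 0" if "a \<in> K" for a
      using K_cases[OF that] section_deriv_nonzero[OF \<phi>(1) open_ball \<phi>(3), of "poly p a"] by metis
    have "inj_on (poly p) K"
    proof (rule inj_onI)
      fix a b assume ab: "a \<in> K" "b \<in> K" "poly p a = poly p b"
      show "a = b"
      proof (cases "cmod (poly p a) = r")
        case True
        then have "(\<phi> \<longlongrightarrow> a) (at (poly p a) within ball 0 r)" "(\<phi> \<longlongrightarrow> b) (at (poly p a) within ball 0 r)"
          using K_cases[OF ab(1)] K_cases[OF ab(2)] ab(3) by auto
        moreover have "at (poly p a) within ball 0 r \<noteq> bot"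
          unfolding trivial_limit_within using True r by (simp add: islimpt_ball)
        ultimately show ?thesis using tendsto_unique by blast
      next
        case False
        then show ?thesis using K_cases[OF ab(1)] K_cases[OF ab(2)] ab(3) by metis
      qed
    qed
    then obtain \<delta> where \<delta>: "\<delta> > 0" "inj_on (poly p) (\<Union>a\<in>K. ball a \<delta>)"
      using injective_near_compact[OF K _ nzK] by blast
    define W where "W = (\<Union>a\<in>K. ball a \<delta>)"
    have "open W" by (auto simp: W_def)
    then have "open (poly p ` W)"
      using open_mapping_thm3[OF poly_is_holomorphic] \<delta>(2) by (simp add: W_def)
    moreover have KW: "K \<subseteq> W" using \<delta>(1) by (auto simp: W_def)
    moreover have "cball 0 r \<subseteq> poly p ` K"
    proof
      fix x :: complex assume x: "x \<in> cball 0 r"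
      show "x \<in> poly p ` K"
      proof (cases "cmod x = r")
        case True
        then show ?thesis using lim[OF True] by force
      next
        case False
        then have xb: "x \<in> ball 0 r" using x by simp
        then have "\<phi> x \<in> K" using closure_subset by (fastforce simp: K_def)
        then show ?thesis using \<phi>(3)[OF xb] by (metis image_eqI)
      qed
    qed
    ultimately obtain \<epsilon> where \<epsilon>: "\<epsilon> > 0" "(\<Union>x\<in>cball 0 r. ball x \<epsilon>) \<subseteq> poly p ` W"
      using compact_subset_open_imp_ball_epsilon_subset[OF compact_cball] by (metis image_mono order_trans)
    have "ball 0 (r + \<epsilon>) \<subseteq> poly p ` W"
    proof
      fix x :: complex assume x: "x \<in> ball 0 (r + \<epsilon>)"
      \<comment> \<open>The point of the closed disc of radius \<open>r\<close> that is nearest to \<open>x\<close>.\<close>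
      define y where "y = (if cmod x \<le> r then x else (r / cmod x) *\<^sub>R x)"
      have "cmod y \<le> r" using r by (auto simp: y_def)
      moreover have "dist y x < \<epsilon>"
      proof (cases "cmod x \<le> r")
        case False
        then have "x \<noteq> 0" using r by auto
        have "y - x = (r / cmod x - 1) *\<^sub>R x" using False by (simp add: y_def scaleR_diff_left)
        then have "dist y x = \<bar>r / cmod x - 1\<bar> * cmod x"
          by (simp only: dist_norm norm_scaleR)
        also have "\<dots> = cmod x - r" using False r \<open>x \<noteq> 0\<close> by (simp add: field_simps abs_if)
        finally show ?thesis using x by simp
      qed (use \<epsilon> in \<open>auto simp: y_def\<close>)
      ultimately have "x \<in> (\<Union>x\<in>cball 0 r. ball x \<epsilon>)" by auto
      then show "x \<in> poly p ` W" using \<epsilon>(2) by blast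
    qed
    moreover have "0 \<in> W"
    proof -
      have "0 \<in> \<phi> ` ball 0 r" using \<phi>(2) r by (metis centre_in_ball image_eqI)
      then show ?thesis
        using KW closure_subset[of "\<phi> ` ball 0 r"] unfolding K_def by blast
    qed
    ultimately obtain \<psi> where "inverse_branch p (r + \<epsilon>) \<psi>"
      using inverse_branch_from_injectivity[OF \<open>open W\<close> _ _ p0] \<delta>(2) by (auto simp: W_def)
    then show False using maximal \<epsilon>(1) by fastforce
  qed
  then show ?thesis
    using that r br unfolding ray_def by blast
qed

section \<open>The exterior of a continuum\<close>

text \<open>
  The harmonic function \<open>Im (p/\<xi>)\<close> vanishes on the boundary of a bounded component \<open>C\<close> of the
  complement, hence on \<open>C\<close>, which contradicts the open mapping theorem. The complement of a
  compact plane set has only one unbounded component.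
\<close>
lemma connected_complement_of_poly_segment:
  fixes p :: "complex poly"
  assumes comp: "compact \<Gamma>" and deg: "degree p > 0" and \<xi>: "\<xi> \<noteq> 0"
    and seg: "\<And>z. z \<in> \<Gamma> \<Longrightarrow> Im (poly p z / \<xi>) = 0"
  shows "connected (- \<Gamma>)"
proof -
  define h where "h z = poly p z / \<xi>" for z
  have h_hol: "h holomorphic_on S" for S
    unfolding h_def using \<xi> by (intro holomorphic_intros poly_is_holomorphic) auto
  have nonconst: "\<not> h constant_on UNIV"
  proof
    assume "h constant_on UNIV"
    then obtain c where c: "\<And>z. h z = c" by (auto simp: constant_on_def)
    then have "poly p z = poly [:c * \<xi>:] z" for z
      using c[of z] \<xi> by (simp add: h_def field_simps)
    then have "p = [:c * \<xi>:]" using poly_eq_poly_eq_iff by blast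
    then show False using deg by simp
  qed
  have unb: "\<not> bounded C" if C: "C \<in> components (- \<Gamma>)" for C
  proof
    assume bC: "bounded C"
    have fr: "frontier C \<subseteq> \<Gamma>"
      using C comp frontier_of_components_closed_complement compact_imp_closed by blast
    have oC: "open C" using C comp open_components compact_imp_closed by blast
    have cont: "continuous_on S (\<lambda>z. c * h z)" for S c
      by (intro continuous_intros holomorphic_on_imp_continuous_on h_hol)
    have zero: "Im (h z) = 0" if z: "z \<in> C" for z
    proof -
      have "Re (c * h z) \<le> 0" if c: "c = \<i> \<or> c = - \<i>" for c
      proof (rule maximum_real_frontier[OF _ cont bC _ z])
        show "(\<lambda>z. c * h z) holomorphic_on interior C" by (intro holomorphic_intros h_hol)
        show "Re (c * h w) \<le> 0" if "w \<in> frontier C" for w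
        proof -
          have "Im (h w) = 0" using seg[of w] fr that by (auto simp: h_def)
          then show ?thesis using c by auto
        qed
      qed
      from this[of "\<i>"] this[of "- \<i>"] show ?thesis by simp
    qed
    have "open (h ` C)"
      by (rule open_mapping_thm[OF h_hol open_UNIV connected_UNIV oC subset_UNIV nonconst])
    moreover obtain z where z: "z \<in> C" using C in_components_nonempty by blast
    ultimately obtain e where e: "e > 0" "ball (h z) e \<subseteq> h ` C"
      using open_contains_ball by blast
    have "h z + of_real (e / 2) * \<i> \<in> ball (h z) e"
      using e(1) by (simp add: dist_norm norm_mult)
    then obtain w where "w \<in> C" "h z + of_real (e / 2) * \<i> = h w" using e(2) by blast
    then have "Im (h z + of_real (e / 2) * \<i>) = 0" using zero by simp
    then show False using zero[OF z] e(1) by simp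
  qed
  have "bounded (- (- \<Gamma>))" using comp compact_imp_bounded by simp
  then show ?thesis
    using cobounded_has_bounded_component[of "- \<Gamma>"] unb by auto
qed

text \<open>
  The image of the complement of \<open>\<Gamma>\<close> on the Riemann sphere under \<open>z \<mapsto> 1/z\<close>, with \<open>0\<close> in the
  role of \<open>\<infinity>\<close>. It lies in the plane because \<open>0\<close> will be a point of \<open>\<Gamma>\<close>.
\<close>
definition inverted_complement :: "complex set \<Rightarrow> complex set"
  where "inverted_complement \<Gamma> = {u. u = 0 \<or> inverse u \<notin> \<Gamma>}"

text \<open>
  The complement of this domain is the inversion of \<open>\<Gamma> - {0}\<close>. It is connected, and it is
  unbounded because \<open>0\<close> is a limit point of \<open>\<Gamma>\<close>; this characterizes simply connected domains.
\<close>
lemma simply_connected_inverted_complement: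
  assumes comp: "compact \<Gamma>" and z0: "0 \<in> \<Gamma>" and lim: "0 islimpt \<Gamma>"
    and con: "connected (\<Gamma> - {0})" and con': "connected (- \<Gamma>)"
  shows "open (inverted_complement \<Gamma>)" and "simply_connected (inverted_complement \<Gamma>)"
proof -
  let ?G = "inverted_complement \<Gamma>"
  obtain b where b: "b > 0" "\<Gamma> \<subseteq> ball 0 b"
    using comp compact_imp_bounded bounded_subset_ballD by blast
  have inv_eq: "inverse ` (- \<Gamma>) = {u. u \<noteq> 0 \<and> inverse u \<notin> \<Gamma>}"
  proof (intro equalityI subsetI)
    fix u assume "u \<in> {u. u \<noteq> 0 \<and> inverse u \<notin> \<Gamma>}"
    then show "u \<in> inverse ` (- \<Gamma>)" by (intro image_eqI[of _ _ "inverse u"]) auto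
  qed (use z0 in auto)
  have small: "inverse u \<notin> \<Gamma>" if "u \<in> ball 0 (inverse b)" "u \<noteq> 0" for u
  proof -
    have "inverse (inverse b) < inverse (cmod u)"
      using that by (intro less_imp_inverse_less) auto
    then have "b < cmod (inverse u)" by (simp add: norm_inverse)
    then show ?thesis using b(2) by auto
  qed
  have G_eq: "?G = ball 0 (inverse b) \<union> inverse ` (- \<Gamma>)"
    unfolding inv_eq inverted_complement_def using small b(1) by auto
  have "open ((- {0}) \<inter> inverse -` (- \<Gamma>) :: complex set)"
    by (intro continuous_open_preimage continuous_intros) (use comp compact_imp_closed in auto)
  also have "(- {0}) \<inter> inverse -` (- \<Gamma>) = inverse ` (- \<Gamma>)"
    unfolding inv_eq by auto
  finally show oG: "open ?G" unfolding G_eq by (intro open_Un open_ball)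
  have "connected (inverse ` (- \<Gamma>))"
    by (rule connected_continuous_image[OF _ con'], intro continuous_intros) (use z0 in auto)
  moreover have "ball 0 (inverse b) \<inter> inverse ` (- \<Gamma>) \<noteq> {}"
  proof -
    define c where "c = inverse b / 2"
    have "0 < c" "c < inverse b" using b(1) by (auto simp: c_def)
    then have "of_real c \<in> ball 0 (inverse b) \<inter> inverse ` (- \<Gamma>)"
      unfolding inv_eq using small[of "of_real c"] by simp
    then show ?thesis by blast
  qed
  ultimately have cG: "connected ?G"
    unfolding G_eq by (intro connected_Un connected_ball)
  have compl: "- ?G = inverse ` (\<Gamma> - {0})"
  proof (intro equalityI subsetI)
    fix u assume "u \<in> - ?G"
    then show "u \<in> inverse ` (\<Gamma> - {0})"
      by (intro image_eqI[of _ _ "inverse u"]) (auto simp: inverted_complement_def)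
  qed (auto simp: inverted_complement_def)
  have con_compl: "connected (- ?G)"
    unfolding compl by (rule connected_continuous_image[OF _ con], intro continuous_intros) auto
  have unb: "\<not> bounded (- ?G)"
  proof
    assume "bounded (- ?G)"
    then obtain B where B: "B > 0" "\<And>u. u \<in> - ?G \<Longrightarrow> cmod u \<le> B"
      by (meson bounded_pos)
    obtain x where x: "x \<in> \<Gamma>" "x \<noteq> 0" "dist x 0 < inverse B"
      using lim B(1) unfolding islimpt_approachable by (metis positive_imp_inverse_positive)
    then have "cmod (inverse x) \<le> B" using B(2)[of "inverse x"] compl by blast
    moreover have "inverse (inverse B) < inverse (cmod x)"
      using x by (intro less_imp_inverse_less) auto
    ultimately show False by (simp add: norm_inverse)
  qed
  then have "components (- ?G) = {- ?G}"
    using con_compl unfolding components_eq_sing_iff by auto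
  then show "simply_connected ?G"
    unfolding simply_connected_eq_unbounded_complement_components[OF oG]
    using cG unb by auto
qed

lemma normalized_riemann_map:
  assumes "open G" "simply_connected G" "0 \<in> G" "G \<noteq> UNIV"
  obtains F H where "F holomorphic_on ball 0 1" "H holomorphic_on G" "F 0 = 0"
    "\<And>z. z \<in> ball 0 1 \<Longrightarrow> F z \<in> G \<and> H (F z) = z"
    "\<And>u. u \<in> G \<Longrightarrow> H u \<in> ball 0 1 \<and> F (H u) = u"
proof -
  have "\<exists>f g. f holomorphic_on G \<and> g holomorphic_on ball 0 1 \<and>
      (\<forall>z\<in>G. f z \<in> ball 0 1 \<and> g (f z) = z) \<and> (\<forall>z\<in>ball 0 1. g z \<in> G \<and> f (g z) = z)"
    using simply_connected_eq_biholomorphic_to_disc[OF assms(1)] assms(2,3,4) by auto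
  then obtain f g where fg: "f holomorphic_on G" "g holomorphic_on ball 0 1"
      "\<And>z. z \<in> G \<Longrightarrow> f z \<in> ball 0 1 \<and> g (f z) = z"
      "\<And>z. z \<in> ball 0 1 \<Longrightarrow> g z \<in> G \<and> f (g z) = z"
    by blast
  have f0: "f 0 \<in> ball 0 1" using fg(3)[OF assms(3)] by simp
  obtain m k where mk: "m (f 0) = 0" "m holomorphic_on ball 0 1" "k holomorphic_on ball 0 1"
      "\<And>z. z \<in> ball 0 1 \<Longrightarrow> m z \<in> ball 0 1" "\<And>z. z \<in> ball 0 1 \<Longrightarrow> k z \<in> ball 0 1"
      "\<And>z. z \<in> ball 0 1 \<Longrightarrow> m (k z) = z" "\<And>z. z \<in> ball 0 1 \<Longrightarrow> k (m z) = z"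
    by (rule ball_biholomorphism_exists[OF f0]) blast
  have k0: "k 0 = f 0" using mk(7)[OF f0] mk(1) by simp
  show thesis
  proof (rule that[of "g \<circ> k" "m \<circ> f"])
    show "g \<circ> k holomorphic_on ball 0 1"
      by (rule holomorphic_on_compose_gen[OF mk(3) fg(2)]) (use mk(5) in auto)
    show "m \<circ> f holomorphic_on G"
      by (rule holomorphic_on_compose_gen[OF fg(1) mk(2)]) (use fg(3) in auto)
    show "(g \<circ> k) 0 = 0" using k0 fg(3)[OF assms(3)] by simp
    show "(g \<circ> k) z \<in> G \<and> (m \<circ> f) ((g \<circ> k) z) = z" if "z \<in> ball 0 1" for z
      using fg(4)[OF mk(5)[OF that]] mk(6)[OF that] by simp
    show "(m \<circ> f) u \<in> ball 0 1 \<and> (g \<circ> k) ((m \<circ> f) u) = u" if "u \<in> G" for u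
      using fg(3)[OF that] mk(4)[of "f u"] mk(7)[of "f u"] by simp
  qed
qed

text \<open>
  In the disc coordinate \<open>\<zeta> = H (1/z)\<close> of the exterior of \<open>\<Gamma>\<close>, the function \<open>q(z) \<zeta>\<^sup>N\<close> has a
  removable singularity at \<open>\<zeta> = 0\<close>, where \<open>z = \<infinity>\<close>, and is bounded by \<open>1\<close> in the limit at the
  unit circle, where \<open>z\<close> approaches \<open>\<Gamma>\<close>. The maximum principle applies.
\<close>
lemma bernstein_walsh:
  assumes F: "F holomorphic_on ball 0 1" and H: "H holomorphic_on inverted_complement \<Gamma>"
    and F0: "F 0 = 0"
    and FH: "\<And>z. z \<in> ball 0 1 \<Longrightarrow> F z \<in> inverted_complement \<Gamma> \<and> H (F z) = z"
    and HF: "\<And>u. u \<in> inverted_complement \<Gamma> \<Longrightarrow> H u \<in> ball 0 1 \<and> F (H u) = u"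
    and \<Gamma>0: "0 \<in> \<Gamma>"
    and deg: "degree q \<le> N" and q: "\<And>z. z \<in> \<Gamma> \<Longrightarrow> cmod (poly q z) \<le> 1"
    and z: "z \<notin> \<Gamma>"
  shows "cmod (poly q z) * cmod (H (inverse z)) ^ N \<le> 1"
proof -
  have inj: "inj_on F (ball 0 1)" using FH by (metis inj_onI)
  \<comment> \<open>The reversed polynomial, padded to degree \<open>N\<close>; it extends \<open>u\<^sup>N q(1/u)\<close> to \<open>u = 0\<close>.\<close>
  define R where "R u = (\<Sum>i\<le>N. coeff q i * u ^ (N - i))" for u
  have R: "R u = u ^ N * poly q (inverse u)" if "u \<noteq> 0" for u
  proof -
    have "poly q (inverse u) = (\<Sum>i\<le>degree q. coeff q i * inverse u ^ i)"
      by (rule poly_altdef)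
    also have "\<dots> = (\<Sum>i\<le>N. coeff q i * inverse u ^ i)"
      using deg by (intro sum.mono_neutral_left) (auto simp: coeff_eq_0)
    finally have "u ^ N * poly q (inverse u) = (\<Sum>i\<le>N. coeff q i * (u ^ N * inverse u ^ i))"
      by (simp add: sum_distrib_left mult_ac)
    also have "\<dots> = R u"
      unfolding R_def using that
      by (intro sum.cong refl) (simp add: power_diff field_simps)
    finally show ?thesis by simp
  qed
  define K where "K \<zeta> = (if \<zeta> = 0 then deriv F 0 else (F \<zeta> - F 0) / (\<zeta> - 0))" for \<zeta>
  have K_hol: "K holomorphic_on ball 0 1"
    unfolding K_def by (rule pole_lemma_open[OF F open_ball])
  have F_nz: "F \<zeta> \<noteq> 0" if "\<zeta> \<in> ball 0 1" "\<zeta> \<noteq> 0" for \<zeta>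
    using inj_onD[OF inj, of \<zeta> 0] F0 that by auto
  have K_nz: "K \<zeta> \<noteq> 0" if "\<zeta> \<in> ball 0 1" for \<zeta>
  proof (cases "\<zeta> = 0")
    case True
    then show ?thesis using holomorphic_injective_imp_regular[OF F open_ball inj, of 0] by (simp add: K_def)
  qed (use F_nz that F0 in \<open>auto simp: K_def\<close>)
  define E where "E \<zeta> = R (F \<zeta>) / K \<zeta> ^ N" for \<zeta>
  have E_hol: "E holomorphic_on ball 0 1"
    unfolding E_def R_def by (intro holomorphic_intros F K_hol) (use K_nz in auto)
  have E_eq: "E \<zeta> = \<zeta> ^ N * poly q (inverse (F \<zeta>))" if "\<zeta> \<in> ball 0 1" "\<zeta> \<noteq> 0" for \<zeta>
    using F_nz[OF that] that F0 by (simp add: E_def R K_def power_divide)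
  define \<zeta>0 where "\<zeta>0 = H (inverse z)"
  have z0: "z \<noteq> 0" using z \<Gamma>0 by auto
  have "inverse z \<in> inverted_complement \<Gamma>" using z by (simp add: inverted_complement_def)
  then have \<zeta>0: "\<zeta>0 \<in> ball 0 1" "F \<zeta>0 = inverse z" using HF by (auto simp: \<zeta>0_def)
  have \<zeta>0_nz: "\<zeta>0 \<noteq> 0" using \<zeta>0(2) F0 z0 by auto
  have bound: "cmod (E \<zeta>0) \<le> 1 + e" if e: "e > 0" for e
  proof -
    define W where "W = {x. cmod (poly q x) < 1 + e}"
    have oW: "open W"
      unfolding W_def by (intro open_Collect_less continuous_intros)
    have \<Gamma>W: "\<Gamma> \<subseteq> W" using q e by (force simp: W_def)
    \<comment> \<open>Together with \<open>0\<close>, the points where \<open>\<bar>q(1/u)\<bar> \<ge> 1 + e\<close> form a compact part of the domain, so its image under \<open>H\<close> keeps a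
      positive distance from the unit circle.\<close>
    define C where "C = {u. u = 0 \<or> inverse u \<notin> W}"
    have CG: "C \<subseteq> inverted_complement \<Gamma>"
      using \<Gamma>W by (auto simp: C_def inverted_complement_def)
    have "open ((- {0}) \<inter> inverse -` W :: complex set)"
      by (intro continuous_open_preimage continuous_intros oW) auto
    then have "closed (- ((- {0}) \<inter> inverse -` W :: complex set))" by (rule closed_Compl)
    also have "- ((- {0}) \<inter> inverse -` W) = C" by (auto simp: C_def)
    finally have "closed C" .
    moreover have "bounded C"
    proof -
      obtain \<eta> where \<eta>: "\<eta> > 0" "ball 0 \<eta> \<subseteq> W"
        using oW \<Gamma>W \<Gamma>0 open_contains_ball by blast
      have "cmod u \<le> inverse \<eta>" if "u \<in> C" for u
      proof (cases "u = 0")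
        case False
        then have "inverse u \<notin> ball 0 \<eta>" using that \<eta>(2) by (auto simp: C_def)
        then have "\<eta> \<le> inverse (cmod u)" by (simp add: norm_inverse)
        then show ?thesis using le_imp_inverse_le[OF _ \<eta>(1)] by fastforce
      qed (use \<eta>(1) in auto)
      then show ?thesis by (auto simp: bounded_iff)
    qed
    ultimately have "compact C" by (simp add: compact_eq_bounded_closed)
    moreover have "continuous_on C H"
      using H CG holomorphic_on_imp_continuous_on continuous_on_subset by blast
    ultimately have HC: "compact (H ` C)" by (intro compact_continuous_image)
    have HC_sub: "H ` C \<subseteq> ball 0 1" using HF CG by blast
    obtain \<rho> where \<rho>: "\<rho> < 1" "\<And>\<zeta>. \<zeta> \<in> H ` C \<Longrightarrow> cmod \<zeta> \<le> \<rho>"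
    proof -
      have "H ` C \<noteq> {}" by (auto simp: C_def)
      then obtain \<zeta>m where "\<zeta>m \<in> H ` C" "\<And>\<zeta>. \<zeta> \<in> H ` C \<Longrightarrow> cmod \<zeta> \<le> cmod \<zeta>m"
        using continuous_attains_sup[OF HC, of cmod] continuous_on_norm[OF continuous_on_id] by blast
      then show thesis using HC_sub by (intro that[of "cmod \<zeta>m"]) auto
    qed
    define m where "m = max 0 (max \<rho> (cmod \<zeta>0))"
    have "m < 1" using \<rho>(1) \<zeta>0(1) by (simp add: m_def)
    then obtain s where s: "m < s" "s < 1" using dense by blast
    have s': "\<rho> < s" "cmod \<zeta>0 < s" "0 < s" using s(1) by (auto simp: m_def)
    have sub: "cball 0 s \<subseteq> (ball 0 1 :: complex set)" using s(2) by auto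
    show ?thesis
    proof (rule maximum_modulus_frontier[of E "cball 0 s"])
      show "E holomorphic_on interior (cball 0 s)"
        by (rule holomorphic_on_subset[OF E_hol]) (use s(2) in auto)
      show "continuous_on (closure (cball 0 s)) E"
        using holomorphic_on_imp_continuous_on[OF E_hol] sub by (auto intro: continuous_on_subset)
      show "cmod (E \<zeta>) \<le> 1 + e" if "\<zeta> \<in> frontier (cball 0 s)" for \<zeta>
      proof -
        have \<zeta>: "cmod \<zeta> = s" using that s'(3) by simp
        then have \<zeta>b: "\<zeta> \<in> ball 0 1" "\<zeta> \<noteq> 0" using s(2) s'(3) by auto
        have "F \<zeta> \<notin> C"
        proof
          assume "F \<zeta> \<in> C"
          then have "H (F \<zeta>) \<in> H ` C" by (rule imageI)
          then have "cmod \<zeta> \<le> \<rho>" using \<rho>(2) FH[OF \<zeta>b(1)] by metis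
          then show False using \<zeta> s'(1) by simp
        qed
        then have "cmod (poly q (inverse (F \<zeta>))) \<le> 1 + e" by (auto simp: C_def W_def)
        moreover have "s ^ N \<le> 1" using s(2) s'(3) by (intro power_le_one) auto
        ultimately have "s ^ N * cmod (poly q (inverse (F \<zeta>))) \<le> 1 * (1 + e)"
          using s'(3) by (intro mult_mono) auto
        then show ?thesis using E_eq[OF \<zeta>b] \<zeta> by (simp add: norm_mult norm_power)
      qed
    qed (use s'(2) in auto)
  qed
  have "cmod (E \<zeta>0) \<le> 1"
    using bound by (rule field_le_epsilon)
  then show ?thesis
    using E_eq[OF \<zeta>0(1) \<zeta>0_nz] \<zeta>0(2) by (simp add: \<zeta>0_def norm_mult norm_power mult.commute)
qed

section \<open>A critical value bound for general polynomials\<close>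

text \<open>
  For large \<open>k\<close> the factor \<open>sinh\<^sup>2 (2\<^sup>k y)\<close> is comparable to \<open>exp (2 y)\<close> to the power \<open>2\<^sup>k\<close>, so
  \<open>exp (2 y) r\<^sup>n\<close> has bounded powers.
\<close>
lemma sinh_doubling_growth:
  fixes y r :: real
  assumes y: "y > 0" and r: "r \<ge> 0"
    and bound: "\<And>k. sinh (2 ^ k * y) ^ 2 * r ^ (n * 2 ^ k) \<le> 1"
  shows "r ^ n \<le> exp (- (2 * y))"
proof (rule ccontr)
  assume "\<not> ?thesis"
  define s where "s = r ^ n * exp (2 * y)"
  have s: "s > 1"
    using \<open>\<not> r ^ n \<le> exp (- (2 * y))\<close> by (simp add: s_def exp_minus field_simps)
  have "\<exists>k. max (1 / y) (17 / (s - 1)) < 2 ^ k"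
    by (rule real_arch_pow) simp
  then obtain k :: nat where k: "max (1 / y) (17 / (s - 1)) < 2 ^ k" ..
  have k1: "2 ^ k * y \<ge> 1" using k y by (simp add: field_simps)
  have sinh_ge: "exp x / 4 \<le> sinh x" if "x \<ge> 1" for x :: real
  proof -
    have "exp (- x) \<le> 1" using that by simp
    moreover have "exp x \<ge> 2" using that exp_ge_add_one_self[of x] by linarith
    moreover have "a / 4 \<le> (a - b) / 2" if "b \<le> 1" "2 \<le> a" for a b :: real
      using that by (simp add: field_simps)
    ultimately show ?thesis unfolding sinh_field_def by blast
  qed
  have "s ^ (2 ^ k) / 16 = (exp (2 ^ k * y) / 4) ^ 2 * r ^ (n * 2 ^ k)"
    by (simp add: s_def power_mult_distrib power_divide power_mult exp_of_nat_mult[symmetric] exp_double mult_ac)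
  also have "\<dots> \<le> sinh (2 ^ k * y) ^ 2 * r ^ (n * 2 ^ k)"
    using sinh_ge[OF k1] r by (intro mult_right_mono power_mono) auto
  also have "\<dots> \<le> 1" by (rule bound)
  finally have "s ^ (2 ^ k) \<le> 16" by simp
  moreover have "1 + real (2 ^ k) * (s - 1) \<le> (1 + (s - 1)) ^ (2 ^ k)"
    by (rule Bernoulli_inequality) (use s in simp)
  moreover have "17 < 2 ^ k * (s - 1)" using k s by (simp add: field_simps)
  ultimately show False by simp
qed

lemma logistic_sinh:
  "poly [:0, 4, -4:] (- of_real ((sinh x)\<^sup>2)) = - (of_real ((sinh (2 * x))\<^sup>2) :: complex)" for x :: real
proof -
  have "(sinh (2 * x))\<^sup>2 = 4 * (sinh x)\<^sup>2 * (1 + (sinh x)\<^sup>2)"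
    unfolding sinh_double power_mult_distrib cosh_square_eq by (simp add: add.commute)
  then show ?thesis
    by (simp add: algebra_simps power2_eq_square)
qed

lemma logistic_unit_interval:
  assumes "t \<in> {0..1::real}"
  shows "4 * t * (1 - t) \<in> {0..1}"
proof -
  have "1 - 4 * t * (1 - t) = (1 - 2 * t)\<^sup>2"
    by (simp add: power2_eq_square algebra_simps)
  then have "1 - 4 * t * (1 - t) \<ge> 0" by (metis zero_le_power2)
  then show ?thesis using assms by simp
qed

text \<open>
  The limit that produces the factor \<open>n\<^sup>2\<close>: the quotient is \<open>coth (y/n)\<close>, so the expression
  behaves like \<open>y\<^sup>2 (n/y)\<^sup>2\<close>.
\<close>
lemma sinh_coth_limit:
  fixes n :: real
  assumes "n > 0"
  shows "((\<lambda>y. (sinh y)\<^sup>2 * (1 + ((1 + exp (- (2 * y / n))) / (1 - exp (- (2 * y / n))))\<^sup>2)) \<longlongrightarrow> n\<^sup>2) (at_right 0)"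
  using assms by real_asymp

text \<open>
  The iterates of \<open>4x(1 - x)\<close> are, up to affine changes of variables, the Chebyshev polynomials of
  degree \<open>2\<^sup>k\<close> for the interval \<open>[0,1]\<close>.
\<close>
definition logistic_iterate :: "complex poly \<Rightarrow> nat \<Rightarrow> complex poly"
  where "logistic_iterate q k = (pcompose [:0, 4, -4:] ^^ k) q"

lemma degree_logistic_iterate: "degree (logistic_iterate q k) = degree q * 2 ^ k"
  by (induction k) (simp_all add: logistic_iterate_def degree_pcompose)

lemma logistic_iterate_unit_interval:
  assumes "t \<in> {0..1::real}" "poly q z = of_real t"
  shows "cmod (poly (logistic_iterate q k) z) \<le> 1"
proof -
  have "\<exists>t\<in>{0..1::real}. poly (logistic_iterate q k) z = of_real t"
  proof (induction k)
    case 0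
    then show ?case using assms by (auto simp: logistic_iterate_def)
  next
    case (Suc k)
    then obtain t where t: "t \<in> {0..1::real}" "poly (logistic_iterate q k) z = of_real t" by blast
    have "poly (logistic_iterate q (Suc k)) z = of_real (4 * t * (1 - t))"
      using t(2) by (simp add: logistic_iterate_def poly_pcompose algebra_simps)
    then show ?case using logistic_unit_interval[OF t(1)] by blast
  qed
  then show ?thesis by auto
qed

text \<open>
  The substitution \<open>x = - sinh\<^sup>2 y\<close> linearizes the logistic map on the negative axis, outside of the
  interval \<open>[0,1]\<close> where its iterates stay bounded.
\<close>
lemma logistic_iterate_sinh:
  fixes y :: real
  assumes "poly q z = - of_real ((sinh y)\<^sup>2)"
  shows "poly (logistic_iterate q k) z = - of_real ((sinh (2 ^ k * y))\<^sup>2)"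
proof (induction k)
  case 0
  then show ?case using assms by (simp add: logistic_iterate_def)
next
  case (Suc k)
  have "poly (logistic_iterate q (Suc k)) z = poly [:0, 4, -4:] (poly (logistic_iterate q k) z)"
    by (simp add: logistic_iterate_def poly_pcompose)
  also have "\<dots> = - of_real ((sinh (2 * (2 ^ k * y)))\<^sup>2)"
    unfolding Suc by (rule logistic_sinh)
  finally show ?case by (simp add: mult.assoc)
qed

text \<open>
  Markov's inequality for the polynomial \<open>p/\<xi>\<close> at the tip \<open>0\<close> of the continuum \<open>\<Gamma>\<close> that joins
  \<open>0\<close> to a critical point.
\<close>
lemma critical_value_bound:
  assumes deg: "degree p \<ge> 2" and p0: "poly p 0 = 0" and p'0: "poly (pderiv p) 0 \<noteq> 0"
  obtains \<omega> where "poly (pderiv p) \<omega> = 0" "poly p \<omega> \<noteq> 0"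
    "cmod (poly (pderiv p) 0) * cmod \<omega> \<le> (real (degree p))\<^sup>2 * cmod (poly p \<omega>)"
proof -
  define n where "n = degree p"
  have n: "n \<ge> 2" using deg by (simp add: n_def)
  have "degree (pderiv p) > 0" using deg by (simp add: degree_pderiv)
  then obtain \<zeta> where "poly (pderiv p) \<zeta> = 0"
    using alg_closed_imp_poly_has_root by blast
  then obtain r \<phi> \<xi> \<omega> where r: "r > 0" and br: "inverse_branch p r \<phi>" and \<xi>: "cmod \<xi> = r"
    and crit: "poly (pderiv p) \<omega> = 0"
    and \<omega>: "\<omega> \<in> closure ((\<lambda>t. \<phi> (of_real t * \<xi>)) ` {0<..<1})"
    by (rule critical_point_on_ray[OF p0 p'0])
  note \<phi> = inverse_branchD[OF br]
  have cont: "continuous_on (ball 0 r) \<phi>"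
    by (rule holomorphic_on_imp_continuous_on[OF \<phi>(1)])
  have isCont: "isCont \<phi> x" if "x \<in> ball 0 r" for x
    using cont that by (simp add: continuous_on_eq_continuous_at)
  have \<xi>0: "\<xi> \<noteq> 0" using \<xi> r by auto
  have on_ball: "of_real t * \<xi> \<in> ball 0 r" if "\<bar>t\<bar> < 1" for t
    using that r \<xi> by (simp add: norm_mult)
  define ray where "ray = (\<lambda>t. \<phi> (of_real t * \<xi>)) ` {0<..<1}"
  define \<Gamma> where "\<Gamma> = closure ray"
  have p_ray: "poly p (\<phi> (of_real t * \<xi>)) = of_real t * \<xi>" if "\<bar>t\<bar> < 1" for t
    using \<phi>(3)[OF on_ball[OF that]] .

  have "ray \<subseteq> {z. cmod (poly p z) \<le> r}"
    using p_ray \<xi> r by (auto simp: ray_def norm_mult)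
  moreover have "bounded {z. cmod (poly p z) \<le> r}"
    by (rule bounded_poly_sublevel) (use deg in simp)
  ultimately have "bounded ray" by (rule bounded_subset[rotated])
  then have comp: "compact \<Gamma>" by (simp add: \<Gamma>_def)
  have seg: "\<exists>t\<in>{0..1}. poly p z = of_real t * \<xi>" if "z \<in> \<Gamma>" for z
  proof -
    define L where "L = (\<lambda>t. of_real t * \<xi>) ` {0..1::real}"
    have "compact L" unfolding L_def by (intro compact_continuous_image continuous_intros compact_Icc)
    then have "closed (poly p -` L)"
      by (intro continuous_closed_vimage compact_imp_closed) (auto intro: continuous_intros)
    moreover have "ray \<subseteq> poly p -` L"
      using p_ray by (auto simp: ray_def L_def intro!: image_eqI[OF refl])
    ultimately have "\<Gamma> \<subseteq> poly p -` L" unfolding \<Gamma>_def by (rule closure_minimal[rotated])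
    then show ?thesis using that by (auto simp: L_def)
  qed
  have seg_Im: "Im (poly p z / \<xi>) = 0" if "z \<in> \<Gamma>" for z
    using seg[OF that] \<xi>0 by auto

  have \<omega>\<Gamma>: "\<omega> \<in> \<Gamma>" using \<omega> by (simp add: \<Gamma>_def ray_def)
  \<comment> \<open>Since \<open>\<omega>\<close> is critical, it is not a value of \<open>\<phi>\<close>, so it is approached only at the far end of
    the radius.\<close>
  have p\<omega>: "poly p \<omega> = \<xi>"
  proof -
    obtain t where t: "t \<in> {0..1}" "poly p \<omega> = of_real t * \<xi>" using seg[OF \<omega>\<Gamma>] by blast
    have "t = 1"
    proof (rule ccontr)
      assume "t \<noteq> 1"
      then have inb: "poly p \<omega> \<in> ball 0 r" using on_ball[of t] t by auto
      from \<omega>\<Gamma> have "\<exists>y. (\<forall>k. y k \<in> ray) \<and> y \<longlonglongrightarrow> \<omega>"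
        unfolding \<Gamma>_def closure_sequential .
      then obtain y where y: "\<forall>k. y k \<in> ray" "y \<longlonglongrightarrow> \<omega>" by blast
      have y_eq: "\<phi> (poly p (y k)) = y k" for k
        using y(1)[rule_format, of k] p_ray by (auto simp: ray_def)
      have "(\<lambda>k. poly p (y k)) \<longlonglongrightarrow> poly p \<omega>" by (intro tendsto_intros y(2))
      then have "(\<lambda>k. \<phi> (poly p (y k))) \<longlonglongrightarrow> \<phi> (poly p \<omega>)"
        by (rule isCont_tendsto_compose[OF isCont[OF inb]])
      then have "y \<longlonglongrightarrow> \<phi> (poly p \<omega>)" unfolding y_eq .
      then have "\<omega> = \<phi> (poly p \<omega>)" using y(2) LIMSEQ_unique by blast
      then show False
        using section_deriv_nonzero[OF \<phi>(1) open_ball \<phi>(3) inb] crit by simp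
    qed
    then show ?thesis using t by simp
  qed
  have \<omega>0: "\<omega> \<noteq> 0" using p\<omega> p0 \<xi>0 by auto

  have nz_ray: "\<phi> (of_real t * \<xi>) \<noteq> 0" if "0 < t" "t < 1" for t
    using p_ray[of t] that p0 \<xi>0 by auto
  have lim0: "0 islimpt ray"
    unfolding islimpt_sequential
  proof (intro exI conjI allI)
    define b where "b k = inverse (real (Suc (Suc k)))" for k
    have b: "0 < b k" "b k < 1" for k by (auto simp: b_def field_simps)
    have "b \<longlonglongrightarrow> 0"
      unfolding b_def by (intro LIMSEQ_Suc[OF LIMSEQ_inverse_real_of_nat])
    then have "(\<lambda>k. of_real (b k) * \<xi>) \<longlonglongrightarrow> of_real 0 * \<xi>"
      by (intro tendsto_mult tendsto_of_real tendsto_const)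
    then have "(\<lambda>k. of_real (b k) * \<xi>) \<longlonglongrightarrow> 0" by simp
    moreover have "isCont \<phi> 0" using r by (intro isCont) simp
    ultimately have "(\<lambda>k. \<phi> (of_real (b k) * \<xi>)) \<longlonglongrightarrow> \<phi> 0"
      by (rule isCont_tendsto_compose[rotated])
    then show "(\<lambda>k. \<phi> (of_real (b k) * \<xi>)) \<longlonglongrightarrow> 0"
      by (simp add: \<phi>(2))
    show "\<phi> (of_real (b k) * \<xi>) \<in> ray - {0}" for k
      using nz_ray[OF b] b by (auto simp: ray_def)
  qed
  then have z0: "0 \<in> \<Gamma>" unfolding \<Gamma>_def by (simp add: closure_def)
  have lim\<Gamma>: "0 islimpt \<Gamma>" using lim0 closure_subset islimpt_subset unfolding \<Gamma>_def by blast
  have "connected ray"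
    unfolding ray_def
  proof (rule connected_continuous_image)
    show "continuous_on {0<..<1} (\<lambda>t. \<phi> (of_real t * \<xi>))"
      by (rule continuous_on_compose2[OF cont]) (use on_ball in \<open>auto intro!: continuous_intros\<close>)
  qed simp
  then have con: "connected (\<Gamma> - {0})"
  proof (rule connected_intermediate_closure)
    have "0 \<notin> ray" using nz_ray by (auto simp: ray_def)
    then show "ray \<subseteq> \<Gamma> - {0}" using closure_subset[of ray] by (auto simp: \<Gamma>_def)
    show "\<Gamma> - {0} \<subseteq> closure ray" by (auto simp: \<Gamma>_def)
  qed
  have con': "connected (- \<Gamma>)"
    by (rule connected_complement_of_poly_segment[OF comp _ \<xi>0 seg_Im]) (use deg in auto)

  define G where "G = inverted_complement \<Gamma>"
  have G: "open G" "simply_connected G"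
    unfolding G_def by (rule simply_connected_inverted_complement[OF comp z0 lim\<Gamma> con con'])+
  have G0: "0 \<in> G" by (simp add: G_def inverted_complement_def)
  have \<omega>G: "inverse \<omega> \<notin> G" using \<omega>\<Gamma> \<omega>0 by (simp add: G_def inverted_complement_def)
  then have "G \<noteq> UNIV" by blast
  then obtain F H where F: "F holomorphic_on ball 0 1" and H: "H holomorphic_on G"
    and F0: "F 0 = 0" and FH: "\<And>z. z \<in> ball 0 1 \<Longrightarrow> F z \<in> G \<and> H (F z) = z"
    and HF: "\<And>u. u \<in> G \<Longrightarrow> H u \<in> ball 0 1 \<and> F (H u) = u"
    using normalized_riemann_map[OF G G0] by metis
  have inj: "inj_on F (ball 0 1)" using FH by (metis inj_onI)

  define m where "m y = ((1 + exp (- (2 * y / real n))) / (1 - exp (- (2 * y / real n))))\<^sup>2" for y :: real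
  \<comment> \<open>Points on the radius opposite to \<open>\<xi>\<close>; their images under \<open>\<phi>\<close> tend to \<open>0\<close> outside of \<open>\<Gamma>\<close>.\<close>
  define h where "h y = - (of_real ((sinh y)\<^sup>2) * \<xi>)" for y :: real
  have norm_h: "cmod (h y) = (sinh y)\<^sup>2 * r" for y
    using \<xi> by (simp add: h_def norm_mult norm_power)
  \<comment> \<open>Combines the two growth estimates for the Riemann map at the point \<open>\<phi> (h y)\<close>.\<close>
  have key: "cmod \<omega> \<le> cmod (\<phi> (h y)) * (1 + m y)" if y: "y > 0" "(sinh y)\<^sup>2 < 1" for y
  proof -
    define z where "z = \<phi> (h y)"
    have hb: "h y \<in> ball 0 r" using y(2) r by (simp add: norm_h)
    have pz: "poly p z = h y" unfolding z_def by (rule \<phi>(3)[OF hb])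
    have z\<Gamma>: "z \<notin> \<Gamma>"
    proof
      assume "z \<in> \<Gamma>"
      then obtain t where t: "t \<in> {0..1}" "h y = of_real t * \<xi>" using seg pz by metis
      then have "of_real t * \<xi> = of_real (- ((sinh y)\<^sup>2)) * \<xi>" by (simp add: h_def)
      then have "t = - ((sinh y)\<^sup>2)" unfolding mult_right_cancel[OF \<xi>0] of_real_eq_iff .
      moreover have "(sinh y)\<^sup>2 > 0" using y(1) by simp
      ultimately show False using t(1) by simp
    qed
    then have zG: "inverse z \<in> G" by (simp add: G_def inverted_complement_def)
    have z_nz: "z \<noteq> 0" using z\<Gamma> z0 by auto
    define \<rho> where "\<rho> = cmod (H (inverse z))"
    have \<rho>: "0 \<le> \<rho>" "\<rho> < 1" using HF[OF zG] by (auto simp: \<rho>_def)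
    define q where "q = smult (inverse \<xi>) p"
    have "(sinh (2 ^ k * y))\<^sup>2 * \<rho> ^ (n * 2 ^ k) \<le> 1" for k
    proof -
      have "poly q z = - of_real ((sinh y)\<^sup>2)" using \<xi>0 by (simp add: q_def pz h_def)
      then have "cmod (poly (logistic_iterate q k) z) = (sinh (2 ^ k * y))\<^sup>2"
        by (subst logistic_iterate_sinh[of q z y]) (simp_all add: norm_power)
      moreover have "cmod (poly (logistic_iterate q k) z) * cmod (H (inverse z)) ^ (n * 2 ^ k) \<le> 1"
      proof (rule bernstein_walsh[OF F H[unfolded G_def] F0 FH[unfolded G_def] HF[unfolded G_def] z0 _ _ z\<Gamma>])
        show "degree (logistic_iterate q k) \<le> n * 2 ^ k"
          using \<xi>0 by (simp add: degree_logistic_iterate q_def n_def)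
        fix x assume "x \<in> \<Gamma>"
        then obtain t where "t \<in> {0..1}" "poly p x = of_real t * \<xi>" using seg by blast
        then show "cmod (poly (logistic_iterate q k) x) \<le> 1"
          using \<xi>0 by (intro logistic_iterate_unit_interval[of t]) (auto simp: q_def)
      qed
      ultimately show ?thesis by (simp add: \<rho>_def)
    qed
    then have "\<rho> ^ n \<le> exp (- (2 * y))"
      by (rule sinh_doubling_growth[OF y(1) \<rho>(1)])
    also have "\<dots> = exp (- (2 * y / real n)) ^ n"
      using n by (simp add: exp_of_nat_mult[symmetric])
    finally have "\<rho> ^ n \<le> exp (- (2 * y / real n)) ^ n" .
    moreover have "n > 0" using n by simp
    ultimately have \<rho>_le: "\<rho> \<le> exp (- (2 * y / real n))"
      using power_mono_iff[OF \<rho>(1) exp_ge_zero] by blast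
    have e1: "exp (- (2 * y / real n)) < 1" using y(1) n by simp
    have "cmod (F (H (inverse z))) \<le> cmod (inverse \<omega>) * (1 + ((1 + \<rho>) / (1 - \<rho>))\<^sup>2)"
      unfolding \<rho>_def
    proof (rule growth_of_univalent_omitting[OF F inj F0])
      show "F x \<noteq> inverse \<omega>" if "x \<in> ball 0 1" for x using FH[OF that] \<omega>G by auto
    qed (use HF[OF zG] in auto)
    also have "F (H (inverse z)) = inverse z" using HF[OF zG] by simp
    also have "((1 + \<rho>) / (1 - \<rho>))\<^sup>2 \<le> m y"
      unfolding m_def
    proof (rule power_mono)
      show "0 \<le> (1 + \<rho>) / (1 - \<rho>)" using \<rho> by simp
      show "(1 + \<rho>) / (1 - \<rho>) \<le> (1 + exp (- (2 * y / real n))) / (1 - exp (- (2 * y / real n)))"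
        using \<rho> \<rho>_le e1 by (intro frac_le) linarith+
    qed
    finally have "inverse (cmod z) \<le> inverse (cmod \<omega>) * (1 + m y)"
      by (simp add: mult_left_mono norm_inverse)
    moreover have "cmod \<omega> > 0" "cmod z > 0" using \<omega>0 z_nz by auto
    ultimately show ?thesis
      unfolding z_def by (simp add: field_simps)
  qed

  define D where "D = deriv \<phi> 0"
  have dD: "(\<phi> has_field_derivative D) (at 0)"
    unfolding D_def by (rule holomorphic_derivI[OF \<phi>(1) open_ball]) (use r in simp)
  have D: "poly (pderiv p) 0 * D = 1"
  proof -
    have "((\<lambda>x. poly p (\<phi> x)) has_field_derivative poly (pderiv p) (\<phi> 0) * D) (at 0)"
      by (rule DERIV_chain2[OF poly_DERIV dD])
    moreover have "((\<lambda>x. poly p (\<phi> x)) has_field_derivative 1) (at 0)"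
      by (rule has_field_derivative_transform_within_open[OF DERIV_ident open_ball[of 0 r]])
         (use r \<phi>(3) in auto)
    ultimately show ?thesis using \<phi>(2) DERIV_unique by metis
  qed
  have h_lim: "filterlim h (at 0) (at_right 0)"
    unfolding filterlim_at
  proof
    show "\<forall>\<^sub>F y in at_right 0. h y \<in> UNIV \<and> h y \<noteq> 0"
      by (rule eventually_mono[OF eventually_at_right_less]) (use \<xi>0 in \<open>simp add: h_def\<close>)
    have "(h \<longlongrightarrow> - (of_real ((sinh 0)\<^sup>2) * \<xi>)) (at_right 0)"
      unfolding h_def by (intro tendsto_intros)
    then show "(h \<longlongrightarrow> 0) (at_right 0)" by simp
  qed
  have "((\<lambda>w. \<phi> w / w) \<longlongrightarrow> D) (at 0)"
    using dD \<phi>(2) by (simp add: has_field_derivative_iff)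
  from tendsto_norm[OF filterlim_compose[OF this h_lim]]
  have quot_lim: "((\<lambda>y. cmod (\<phi> (h y) / h y)) \<longlongrightarrow> cmod D) (at_right 0)" .
  have "((\<lambda>y. cmod (\<phi> (h y) / h y) * (r * ((sinh y)\<^sup>2 * (1 + m y)))) \<longlongrightarrow> cmod D * (r * (real n)\<^sup>2)) (at_right 0)"
    unfolding m_def using n by (intro tendsto_mult quot_lim tendsto_const sinh_coth_limit) simp
  moreover have "\<forall>\<^sub>F y in at_right 0. cmod \<omega> \<le> cmod (\<phi> (h y) / h y) * (r * ((sinh y)\<^sup>2 * (1 + m y)))"
  proof -
    have "((\<lambda>y::real. (sinh y)\<^sup>2) \<longlongrightarrow> (sinh 0)\<^sup>2) (at_right 0)" by (intro tendsto_intros)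
    then have "\<forall>\<^sub>F y in at_right (0::real). (sinh y)\<^sup>2 < 1"
      by (rule order_tendstoD) simp
    then show ?thesis
      using eventually_at_right_less[of 0]
    proof eventually_elim
      case (elim y)
      have "cmod (\<phi> (h y) / h y) * (r * (sinh y)\<^sup>2) = cmod (\<phi> (h y))"
        using elim r by (simp add: norm_divide norm_h)
      then show ?case using key[of y] elim by (simp add: mult.assoc[symmetric])
    qed
  qed
  ultimately have "cmod \<omega> \<le> cmod D * (r * (real n)\<^sup>2)"
    by (intro tendsto_lowerbound[where F = "at_right (0::real)"]) auto
  then have "cmod (poly (pderiv p) 0) * cmod \<omega> \<le> cmod (poly (pderiv p) 0) * (cmod D * (r * (real n)\<^sup>2))"
    by (intro mult_left_mono) auto
  also have "\<dots> = cmod (poly (pderiv p) 0 * D) * (r * (real n)\<^sup>2)"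
    by (simp add: norm_mult)
  also have "\<dots> = (real (degree p))\<^sup>2 * cmod (poly p \<omega>)"
    by (simp add: D p\<omega> \<xi> n_def)
  finally show thesis using that crit p\<omega> \<xi>0 by blast
qed

section \<open>Odd polynomials\<close>

text \<open>
  Induction on the degree: removing the constant term and one factor \<open>z\<close> leaves an odd
  polynomial, which vanishes at \<open>0\<close>, and removing another factor \<open>z\<close> leaves an even one.
\<close>
lemma even_poly_is_poly_in_square:
  fixes S :: "complex poly"
  assumes "\<And>z. poly S (- z) = poly S z"
  shows "\<exists>T. S = pcompose T [:0, 0, 1:]"
  using assms
proof (induction "degree S" arbitrary: S rule: less_induct)
  case less
  show ?case
  proof (cases "degree S = 0")
    case True
    then obtain a where "S = [:a:]" by (metis degree_eq_zeroE)
    then have "S = pcompose [:a:] [:0, 0, 1:]" by simp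
    then show ?thesis ..
  next
    case False
    obtain a S1 where S1: "S = pCons a S1" by (cases S)
    have odd: "poly S1 (- z) = - poly S1 z" if "z \<noteq> 0" for z
    proof -
      have "- (z * poly S1 (- z)) = z * poly S1 z" using less.prems[of z] by (simp add: S1)
      then have "z * (poly S1 (- z) + poly S1 z) = 0"
        unfolding distrib_left by (metis add.right_inverse)
      then show ?thesis using that by (simp add: add_eq_0_iff2)
    qed
    have "poly S1 0 = 0"
    proof -
      have "poly ([:0, 1:] * (pcompose S1 [:0, -1:] + S1)) z = 0" for z
        using odd[of z] by (cases "z = 0") (simp_all add: poly_pcompose)
      then have "[:0, 1:] * (pcompose S1 [:0, -1:] + S1) = 0"
        using poly_all_0_iff_0 by blast
      then have "pcompose S1 [:0, -1:] + S1 = 0" by simp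
      then have "poly (pcompose S1 [:0, -1:] + S1) 0 = 0" by simp
      then show ?thesis by (simp add: poly_pcompose)
    qed
    then obtain S2 where S2: "S1 = pCons 0 S2"
      by (metis pCons_cases poly_pCons mult_zero_left add_0_right)
    have even: "poly S2 (- z) = poly S2 z" for z
      using odd[of z] by (cases "z = 0") (auto simp: S2)
    have "degree S2 < degree S"
      using False by (auto simp: S1 S2 degree_pCons_eq_if split: if_splits)
    then obtain T where T: "S2 = pcompose T [:0, 0, 1:]"
      using less.hyps even by blast
    have "S = pcompose (pCons a T) [:0, 0, 1:]"
      by (simp add: pcompose_pCons T[symmetric] S1 S2)
    then show ?thesis ..
  qed
qed

text \<open>
  Passing to \<open>P\<^sup>2\<close> as a polynomial in \<open>z\<^sup>2\<close> keeps the degree and the normalization at \<open>0\<close>.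
\<close>
lemma square_of_odd_poly:
  fixes P :: "complex poly"
  assumes odd: "\<And>z. poly P (- z) = - poly P z" and P0: "poly P 0 = 0"
  obtains p where "P\<^sup>2 = pcompose p [:0, 0, 1:]" "degree p = degree P" "poly p 0 = 0"
    "poly (pderiv p) 0 = (poly (pderiv P) 0)\<^sup>2"
proof -
  obtain p where p: "P\<^sup>2 = pcompose p [:0, 0, 1:]"
    using even_poly_is_poly_in_square[of "P\<^sup>2"] odd by auto
  have "degree p * 2 = 2 * degree P"
    using arg_cong[OF p, of degree] by (cases "P = 0") (simp_all add: degree_power_eq degree_pcompose)
  then have deg: "degree p = degree P" by simp
  have p0: "poly p 0 = 0"
    using arg_cong[OF p, of "\<lambda>q. poly q 0"] P0 by (simp add: poly_pcompose)
  obtain P1 where P1: "P = pCons 0 P1"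
    using P0 by (metis pCons_cases poly_pCons mult_zero_left add_0_right)
  obtain p1 where p1: "p = pCons 0 p1"
    using p0 by (metis pCons_cases poly_pCons mult_zero_left add_0_right)
  have "[:0, 0, 1:] * P1\<^sup>2 = [:0, 0, 1:] * pcompose p1 [:0, 0, 1:]"
    using p by (simp add: P1 p1 pcompose_pCons power2_eq_square)
  then have "P1\<^sup>2 = pcompose p1 [:0, 0, 1:]" by simp
  from arg_cong[OF this, of "\<lambda>q. poly q 0"] have "poly p1 0 = (poly P1 0)\<^sup>2"
    by (simp add: poly_pcompose)
  then have "poly (pderiv p) 0 = (poly (pderiv P) 0)\<^sup>2"
    by (simp add: P1 p1 pderiv_pCons)
  with p deg p0 that show thesis by blast
qed

theorem theorem1p4:
  fixes P :: "complex poly" and d :: nat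
  assumes "\<And>z. poly P (- z) = - poly P z"
    and "degree P = d" and "d \<ge> 3"
    and "poly P 0 = 0"
    and "poly (pderiv P) 0 = 1"
  shows "(MAX \<zeta>\<in>{\<zeta>. poly (pderiv P) \<zeta> = 0}. cmod (poly P \<zeta> / \<zeta>)) \<ge> 1 / real d"
proof -
  obtain p where p: "P\<^sup>2 = pcompose p [:0, 0, 1:]" "degree p = degree P" "poly p 0 = 0"
      "poly (pderiv p) 0 = (poly (pderiv P) 0)\<^sup>2"
    using square_of_odd_poly[OF assms(1,4)] by blast
  obtain \<omega> where \<omega>: "poly (pderiv p) \<omega> = 0" "poly p \<omega> \<noteq> 0"
      "cmod (poly (pderiv p) 0) * cmod \<omega> \<le> (real (degree p))\<^sup>2 * cmod (poly p \<omega>)"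
    using critical_value_bound[of p] p assms by auto
  define \<zeta> where "\<zeta> = csqrt \<omega>"
  have \<zeta>: "\<zeta>\<^sup>2 = \<omega>" by (simp add: \<zeta>_def)
  have P\<zeta>: "(poly P \<zeta>)\<^sup>2 = poly p \<omega>"
    using arg_cong[OF p(1), of "\<lambda>q. poly q \<zeta>"] \<zeta>
    by (simp add: poly_pcompose power2_eq_square)
  have "2 * poly P \<zeta> * poly (pderiv P) \<zeta> = poly (pderiv p) \<omega> * (2 * \<zeta>)"
    using arg_cong[OF p(1), of "\<lambda>q. poly (pderiv q) \<zeta>"] \<zeta>
    by (simp add: poly_pcompose pderiv_pcompose pderiv_pCons pderiv_mult power2_eq_square)
  then have crit: "poly (pderiv P) \<zeta> = 0"
    using \<omega>(1,2) P\<zeta> by auto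
  have "\<omega> \<noteq> 0" using \<omega>(2) p(3) by auto
  have "cmod \<omega> \<le> (real d)\<^sup>2 * cmod (poly p \<omega>)"
    using \<omega>(3) p(2,4) assms(2,5) by simp
  then have "(cmod \<zeta>)\<^sup>2 \<le> (real d * cmod (poly P \<zeta>))\<^sup>2"
    by (simp add: norm_power[symmetric] \<zeta> P\<zeta> power_mult_distrib)
  then have "cmod \<zeta> \<le> real d * cmod (poly P \<zeta>)"
    by (rule power2_le_imp_le) simp
  moreover have "cmod \<zeta> > 0" using \<open>\<omega> \<noteq> 0\<close> \<zeta> by auto
  ultimately have "1 / real d \<le> cmod (poly P \<zeta> / \<zeta>)"
    using assms(3) by (simp add: norm_divide field_simps)
  also have "\<dots> \<le> (MAX \<zeta>\<in>{\<zeta>. poly (pderiv P) \<zeta> = 0}. cmod (poly P \<zeta> / \<zeta>))"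
  proof (rule Max_ge)
    have "pderiv P \<noteq> 0" using assms(5) by auto
    then show "finite ((\<lambda>\<zeta>. cmod (poly P \<zeta> / \<zeta>)) ` {\<zeta>. poly (pderiv P) \<zeta> = 0})"
      by (intro finite_imageI poly_roots_finite)
  qed (use crit in auto)
  finally show ?thesis .
qed

end
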